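(* Let $r=r_0$, let $P$ be the uniform Cantor distribution with parameter $r_0$, let $n\ge2$, and let $I\subset\{1,2\}^{\ell(n)}$ with $\mathrm{card}(I)=n-2^{\ell(n)}$. Then $\beta_n(I)$ forms an optimal set of $n$-means for $P$.
   Context: Let $r_0\approx 0.4350411707$ be the unique real number $r\in(0,\frac12)$ with $(r-1)(r^4+r^2)=\frac16\left(r^7+r^6+4r^5-2r^4-2r^3-8r^2+9r-3\right)$. For $0<r<\frac12$ let $S_1(x)=rx$ and $S_2(x)=rx+1-r$ on $\mathbb R$, and let $P$ (the uniform Cantor distribution with parameter $r$) be the unique Borel probability measure on $\mathbb R$ with $P=\frac12 P\circ S_1^{-1}+\frac12 P\circ S_2^{-1}$. For a word $\sigma=\sigma_1\cdots\sigma_k\in\{1,2\}^k$ put $S_\sigma=S_{\sigma_1}\circ\cdots\circ S_{\sigma_k}$ and $J_\sigma=S_\sigma([0,1])$; $\sigma\tau$ denotes concatenation. Let $a_\sigma=S_\sigma(\frac12)$ be the midpoint of $J_\sigma$. Optimal sets: for a finite set $\alpha\subset\mathbb R$ let $V(P,\alpha)=\int\min_{a\in\alpha}(x-a)^2\,dP(x)$, and $V_n=\inf\{V(P,\alpha):\alpha\subset\mathbb R,\ \mathrm{card}(\alpha)\le n\}$. A set $\alpha$ with $\mathrm{card}(\alpha)\le n$ is an optimal set of $n$-means for $P$ if $V(P,\alpha)=V_n$. The sets $\beta_n(I)$: for $n\ge2$ let $\ell(n)$ be the unique natural number with $2^{\ell(n)}\le n<2^{\ell(n)+1}$. For $I\subset\{1,2\}^{\ell(n)}$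 with $\mathrm{card}(I)=n-2^{\ell(n)}$, $$\beta_n(I)=\{a_\sigma:\sigma\in\{1,2\}^{\ell(n)}\setminus I\}\cup\{a_{\sigma1}:\sigma\in I\}\cup\{a_{\sigma2}:\sigma\in I\}.$$ *)

theory Defs
  imports "HOL-Analysis.Analysis" "HOL-Probability.Probability"
begin

definition r0 :: real where
  "r0 = (THE r. 0 < r \<and> r < 1/2 \<and>
     (r - 1) * (r^4 + r^2) =
       (1/6) * (r^7 + r^6 + 4 * r^5 - 2 * r^4 - 2 * r^3 - 8 * r^2 + 9 * r - 3))"

definition S1 :: "real \<Rightarrow> real \<Rightarrow> real" where
  "S1 r x = r * x"

definition S2 :: "real \<Rightarrow> real \<Rightarrow> real" where
  "S2 r x = r * x + 1 - r"

definition uniform_cantor_distribution :: "real \<Rightarrow> real measure \<Rightarrow> bool" where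
  "uniform_cantor_distribution r P \<longleftrightarrow>
     prob_space P \<and> sets P = sets borel \<and>
     (\<forall>A \<in> sets borel.
        measure P A = 1/2 * measure P (S1 r -` A) + 1/2 * measure P (S2 r -` A))"

definition words :: "nat \<Rightarrow> nat list set" where
  "words k = {\<sigma>. length \<sigma> = k \<and> set \<sigma> \<subseteq> {1, 2}}"

(* The empty word gives the identity; letters other than 1 and 2 never occur in words. *)
definition S_word :: "real \<Rightarrow> nat list \<Rightarrow> real \<Rightarrow> real" where
  "S_word r \<sigma> = foldr (\<lambda>i f. (if i = 1 then S1 r else S2 r) \<circ> f) \<sigma> id"

definition a_word :: "real \<Rightarrow> nat list \<Rightarrow> real" where
  "a_word r \<sigma> = S_word r \<sigma> (1/2)"

(* Only meaningful for nonempty finite alpha, since Min {} is unspecified. For the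
   compactly supported measures considered here the integrand is integrable, so the
   Bochner integral does not take its default value 0. *)
definition distortion :: "real measure \<Rightarrow> real set \<Rightarrow> real" where
  "distortion P \<alpha> = (\<integral>x. Min ((\<lambda>a. (x - a)^2) ` \<alpha>) \<partial>P)"

definition quantization_error :: "real measure \<Rightarrow> nat \<Rightarrow> real" where
  "quantization_error P n =
     (INF \<alpha> \<in> {\<alpha>. finite \<alpha> \<and> \<alpha> \<noteq> {} \<and> card \<alpha> \<le> n}. distortion P \<alpha>)"

definition optimal_n_means :: "real measure \<Rightarrow> nat \<Rightarrow> real set \<Rightarrow> bool" where
  "optimal_n_means P n \<alpha> \<longleftrightarrow>
     finite \<alpha> \<and> \<alpha> \<noteq> {} \<and> card \<alpha> \<le> n \<and> distortion P \<alpha> = quantization_error P n"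

definition ell :: "nat \<Rightarrow> nat" where
  "ell n = (THE l. 2 ^ l \<le> n \<and> n < 2 ^ (l + 1))"

definition beta :: "real \<Rightarrow> nat \<Rightarrow> nat list set \<Rightarrow> real set" where
  "beta r n I =
     {a_word r \<sigma> | \<sigma>. \<sigma> \<in> words (ell n) - I}
     \<union> {a_word r (\<sigma> @ [1]) | \<sigma>. \<sigma> \<in> I}
     \<union> {a_word r (\<sigma> @ [2]) | \<sigma>. \<sigma> \<in> I}"

end

theory Submission
  imports Defs
begin

text \<open>
Write \<open>cost A\<close> for the distortion of a codebook \<open>A\<close> and \<open>D n\<close> for the cost of the codebook with \<open>n\<close> points
distributed evenly over the halves of the Cantor set, recursively. The codebooks of the theorem have cost
at most \<open>D n\<close> (\<open>cost_beta_le\<close>), so everything rests on the lower bound \<open>D (card A) \<le> cost A\<close>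
(\<open>D_le_cost\<close>), proved by induction on the number of points.

By self-similarity the cost of \<open>A\<close> is, up to the factor \<open>r^2 / 2\<close>, the sum of the costs of two rescaled
codebooks, one for each half. If no point serves both halves, these have fewer points, and the
claim follows by induction and the convexity of \<open>D\<close> (\<open>halves_le\<close>). Otherwise one point \<open>a\<close> is
shared. Seen from a half, it is a helper: a code point on the right which may lie outside the unit interval.
If both halves are rescaled and the right one is mirrored, the two coordinates of \<open>a\<close> add up to
\<open>1 / r\<close>. It has to be shown that the helper is not worth more to the two halves together than a
point of its own is worth to one of them.

Consider the half from which \<open>a\<close> is farther away. If it has at least four further points, or two or
three but \<open>a\<close> is very far away, then the helper is worthless there: either the codebook already
reaches so far to the right that nothing is nearer to the helper, or it leaves out the rightmost
part of the support, and then replacing the helper by the midpoint of a suitable small interval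
saves more than an additional point can gain (\<open>helper_bound\<close>). With two or three further points
and a closer helper, the same argument bounds its benefit by a small number.

The essential case is that of one further point in each half, the case of three points (\<open>tie\<close>). Here
the critical ratio is exactly the one at which a symmetric codebook with a shared point \<open>1/2\<close> has
the same cost as the codebook of the theorem, so there is no room for estimates near these two
configurations. The cost of a pair \<open>t \<le> s\<close> is \<open>V + (t - 1/2)^2 - 2 (s - t) \<psi>((s + t) / 2)\<close> with the convex
function \<open>\<psi>(b)\<close>, the mean of \<open>max 0 (x - b)\<close>. Replacing \<open>\<psi>\<close> by a polygon above it, which
coincides with \<open>\<psi>\<close> at the end points of finitely many basic intervals, bounds the cost of each of the two
pairs from below by a minimum of finitely many quadratic polynomials. For the two sharp
combinations the inequality is an identity plus squares, one of which uses the equation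
for the critical ratio. For each of the others it says that a discriminant is not positive, and a
subdivision into thirteen intervals is fine enough for this to be checked in integer arithmetic
(\<open>pairs_ok_vertices\<close>).
\<close>


section \<open>Self-similarity, support and moments\<close>

locale cantor = prob_space P for P :: "real measure" +
  fixes r :: real
  assumes r_pos: "0 < r" and r_half: "r < 1/2"
    and ucd: "uniform_cantor_distribution r P"
begin

lemma sets_P [measurable_cong]: "sets P = sets borel"
  using ucd by (simp add: uniform_cantor_distribution_def)

lemma space_P: "space P = UNIV"
  using sets_eq_imp_space_eq[OF sets_P] by simp

lemma S_maps: "x \<in> {0..1} \<Longrightarrow> S1 r x \<in> {0..1}" "x \<in> {0..1} \<Longrightarrow> S2 r x \<in> {0..1}"
proof -
  assume x: "x \<in> {0..1}"
  have "0 \<le> r * x" "r * x \<le> r * 1"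
    using x r_pos by (auto intro!: mult_left_mono)
  then show "S1 r x \<in> {0..1}" "S2 r x \<in> {0..1}"
    using r_half by (auto simp: S1_def S2_def)
qed

lemma prob_self:
  assumes "A \<in> sets borel"
  shows "prob A = 1/2 * prob (S1 r -` A) + 1/2 * prob (S2 r -` A)"
  using ucd assms by (auto simp: uniform_cantor_distribution_def)

lemma measurable_S [measurable]: "S1 r \<in> borel_measurable borel" "S2 r \<in> borel_measurable borel"
  unfolding S1_def[abs_def] S2_def[abs_def] by measurable

text \<open>
Both similarities map the \<open>e\<close>-neighbourhood of the unit interval into its \<open>r*e\<close>-neighbourhood, so mass
can only flow inwards. Iterating this pushes all the mass into the unit interval.
\<close>

lemma prob_neighbourhood_step:
  assumes "e \<ge> 0"
  shows "prob {-e..1+e} \<le> prob {-(r*e)..1+r*e}"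
proof -
  let ?A = "{-(r*e)..1+r*e}"
  have 1: "{-e..1+e} \<subseteq> S1 r -` ?A"
  proof
    fix x assume "x \<in> {-e..1+e}"
    then have "-e \<le> x" "x \<le> 1+e" by auto
    then have "r * (-e) \<le> r * x" "r * x \<le> r * (1+e)"
      using r_pos by (intro mult_left_mono; simp)+
    then show "x \<in> S1 r -` ?A" using r_half by (auto simp: S1_def algebra_simps)
  qed
  have 2: "{-e..1+e} \<subseteq> S2 r -` ?A"
  proof
    fix x assume "x \<in> {-e..1+e}"
    then have "-e \<le> x" "x \<le> 1+e" by auto
    then have "r * (-e) \<le> r * x" "r * x \<le> r * (1+e)"
      using r_pos by (intro mult_left_mono; simp)+
    then show "x \<in> S2 r -` ?A" using r_half by (auto simp: S2_def algebra_simps)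
  qed
  have m: "S1 r -` ?A \<in> sets P" "S2 r -` ?A \<in> sets P"
    using measurable_sets[OF measurable_S(1), of ?A] measurable_sets[OF measurable_S(2), of ?A]
    by (auto simp: sets_P)
  have "prob {-e..1+e} \<le> prob (S1 r -` ?A)" "prob {-e..1+e} \<le> prob (S2 r -` ?A)"
    using 1 2 m by (auto intro!: finite_measure_mono)
  then show ?thesis using prob_self[of ?A] by simp
qed

lemma prob_unit: "prob {0..1} = 1"
proof -
  have step: "prob {-e..1+e} \<le> prob {-(r^n*e)..1+r^n*e}" if "e \<ge> 0" for e n
  proof (induction n)
    case (Suc n)
    have "0 \<le> r^n*e" using that r_pos by simp
    from prob_neighbourhood_step[OF this] Suc show ?case by (simp add: mult.assoc)
  qed simp
  have le: "prob {-e..1+e} \<le> prob {0..1}" if e: "e \<ge> 0" for e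
  proof -
    let ?A = "\<lambda>n. {-(r^n*e)..1+r^n*e}"
    have dec: "decseq ?A"
    proof (rule decseq_SucI)
      fix n
      have "r^Suc n * e \<le> r^n * e"
        using r_pos r_half e by (intro mult_right_mono power_decreasing) auto
      then show "?A (Suc n) \<subseteq> ?A n" by auto
    qed
    have lim0: "(\<lambda>n. r^n*e) \<longlonglongrightarrow> 0"
      using r_pos r_half by (auto intro!: tendsto_eq_intros LIMSEQ_power_zero)
    have Int: "(\<Inter>n. ?A n) = {0..1}"
    proof
      show "(\<Inter>n. ?A n) \<subseteq> {0..1}"
      proof
        fix x assume x: "x \<in> (\<Inter>n. ?A n)"
        have "(\<lambda>n. -(r^n*e)) \<longlonglongrightarrow> 0" using tendsto_minus[OF lim0] by simp
        then have "0 \<le> x" by (rule LIMSEQ_le_const2) (use x in auto)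
        moreover have "(\<lambda>n. 1+r^n*e) \<longlonglongrightarrow> 1" using tendsto_add[OF tendsto_const lim0, of 1] by simp
        then have "x \<le> 1" by (rule LIMSEQ_le_const) (use x in auto)
        ultimately show "x \<in> {0..1}" by simp
      qed
      show "{0..1} \<subseteq> (\<Inter>n. ?A n)"
      proof -
        have "0 \<le> r^n*e" for n using e r_pos by simp
        then have "{0..1} \<subseteq> ?A n" for n
          by (smt (verit) atLeastAtMost_iff subsetI)
        then show ?thesis by blast
      qed
    qed
    have "(\<lambda>n. prob (?A n)) \<longlonglongrightarrow> prob (\<Inter>n. ?A n)"
      by (rule finite_Lim_measure_decseq[OF _ dec]) (auto simp: sets_P)
    then show ?thesis unfolding Int
      by (rule LIMSEQ_le_const) (use step[OF e] in auto)
  qed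
  let ?B = "\<lambda>k::nat. {-real k..1+real k}"
  have inc: "incseq ?B" by (rule incseq_SucI) auto
  have UN: "(\<Union>k. ?B k) = space P"
  proof -
    have "\<exists>k. x \<in> ?B k" for x :: real
    proof -
      obtain k where "\<bar>x\<bar> \<le> real k" using real_arch_simple by blast
      then show ?thesis by (intro exI[of _ k]) auto
    qed
    then show ?thesis by (auto simp: space_P)
  qed
  have "(\<lambda>k. prob (?B k)) \<longlonglongrightarrow> prob (\<Union>k. ?B k)"
    by (rule finite_Lim_measure_incseq[OF _ inc]) (auto simp: sets_P)
  then have "(\<lambda>k. prob (?B k)) \<longlonglongrightarrow> 1" unfolding UN prob_space .
  then have "1 \<le> prob {0..1}"
    by (rule LIMSEQ_le_const2) (use le in auto)
  then show ?thesis using prob_le_1[of "{0..1}"] by simp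
qed

lemma AE_unit: "AE x in P. x \<in> {0..1}"
  by (rule AE_prob_1[OF prob_unit])

text \<open>
The hypothesis on the measure, transferred from indicators to integrals. The factor stands on the
left because division is awkward for \<^typ>\<open>ennreal\<close>.
\<close>

lemma nn_integral_self:
  assumes "f \<in> borel_measurable borel"
  shows "2 * (\<integral>\<^sup>+x. f x \<partial>P) = (\<integral>\<^sup>+x. f (S1 r x) \<partial>P) + (\<integral>\<^sup>+x. f (S2 r x) \<partial>P)"
  using assms
proof (induction rule: borel_measurable_induct)
  case (cong f g)
  then show ?case by simp
next
  case (set A)
  have A: "A \<in> sets borel" using set by simp
  have m: "S1 r -` A \<in> sets P" "S2 r -` A \<in> sets P"
    using measurable_sets[OF measurable_S(1) A] measurable_sets[OF measurable_S(2) A]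
    by (auto simp: sets_P)
  have i: "(\<lambda>x. indicator A (S1 r x) :: ennreal) = indicator (S1 r -` A)"
    "(\<lambda>x. indicator A (S2 r x) :: ennreal) = indicator (S2 r -` A)"
    by (auto simp: indicator_def fun_eq_iff)
  have "2 * emeasure P A = emeasure P (S1 r -` A) + emeasure P (S2 r -` A)"
  proof -
    have e: "2 * prob A = prob (S1 r -` A) + prob (S2 r -` A)" using prob_self[OF A] by simp
    have "2 * ennreal (prob A) = ennreal (2 * prob A)" by (simp add: ennreal_mult)
    also have "\<dots> = ennreal (prob (S1 r -` A)) + ennreal (prob (S2 r -` A))" by (simp add: e)
    finally show ?thesis by (simp add: emeasure_eq_measure)
  qed
  then show ?case unfolding i using m A by (simp add: sets_P)
next
  case (mult u c)
  then show ?case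
    by (simp add: nn_integral_cmult mult.left_commute[of 2] flip: distrib_left)
next
  case (add u v)
  then show ?case by (simp add: nn_integral_add algebra_simps)
next
  case (seq U)
  have sup: "(SUP i. U i) x = (SUP i. U i x)" for x by (simp add: image_image)
  have inc: "incseq (\<lambda>i x. U i (S1 r x))" "incseq (\<lambda>i x. U i (S2 r x))"
    using seq by (auto simp: incseq_def le_fun_def)
  have [measurable]: "U i \<in> borel_measurable borel" for i using seq by simp
  have a: "(\<integral>\<^sup>+x. (SUP i. U i x) \<partial>P) = (SUP i. \<integral>\<^sup>+x. U i x \<partial>P)"
    by (rule nn_integral_monotone_convergence_SUP) (use seq in auto)
  have b: "(\<integral>\<^sup>+x. (SUP i. U i (S1 r x)) \<partial>P) = (SUP i. \<integral>\<^sup>+x. U i (S1 r x) \<partial>P)"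
    by (rule nn_integral_monotone_convergence_SUP) (use inc in auto)
  have c: "(\<integral>\<^sup>+x. (SUP i. U i (S2 r x)) \<partial>P) = (SUP i. \<integral>\<^sup>+x. U i (S2 r x) \<partial>P)"
    by (rule nn_integral_monotone_convergence_SUP) (use inc in auto)
  have "2 * (SUP i. \<integral>\<^sup>+x. U i x \<partial>P) = (SUP i. 2 * \<integral>\<^sup>+x. U i x \<partial>P)"
    by (rule SUP_mult_left_ennreal)
  also have "\<dots> = (SUP i. (\<integral>\<^sup>+x. U i (S1 r x) \<partial>P) + (\<integral>\<^sup>+x. U i (S2 r x) \<partial>P))"
    using seq by simp
  also have "\<dots> = (SUP i. \<integral>\<^sup>+x. U i (S1 r x) \<partial>P) + (SUP i. \<integral>\<^sup>+x. U i (S2 r x) \<partial>P)"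
    by (rule ennreal_SUP_add)
      (use inc in \<open>auto intro!: incseq_nn_integral\<close>)
  finally show ?case unfolding sup a b c .
qed

lemma integrable_cont:
  assumes "continuous_on UNIV f"
  shows "integrable P (f :: real \<Rightarrow> real)"
proof -
  have "bounded (f ` {0..1})"
    by (intro compact_imp_bounded compact_continuous_image continuous_on_subset[OF assms]) auto
  then obtain B where B: "\<And>x. x \<in> {0..1} \<Longrightarrow> norm (f x) \<le> B"
    unfolding bounded_iff by (metis imageI real_norm_def)
  have [measurable]: "f \<in> borel_measurable borel"
    by (rule borel_measurable_continuous_onI[OF assms])
  show ?thesis
    by (rule integrable_const_bound[of _ B]) (use AE_unit B in \<open>auto elim: eventually_mono\<close>)
qed

lemma cont_S:
  assumes "continuous_on UNIV (f :: real \<Rightarrow> real)"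
  shows "continuous_on UNIV (\<lambda>x. f (S1 r x))" "continuous_on UNIV (\<lambda>x. f (S2 r x))"
  unfolding S1_def S2_def
  by (auto intro!: continuous_on_compose2[OF assms] continuous_intros)

abbreviation mean :: "(real \<Rightarrow> real) \<Rightarrow> real" where
  "mean f \<equiv> integral\<^sup>L P f"

text \<open>
Adding a constant makes a continuous function nonnegative on the support, which reduces the claim
to nonnegative integrals.
\<close>

lemma mean_self:
  assumes f: "continuous_on UNIV f"
  shows "mean f = (mean (\<lambda>x. f (S1 r x)) + mean (\<lambda>x. f (S2 r x))) / 2"
proof -
  have "bounded (f ` {0..1})"
    by (intro compact_imp_bounded compact_continuous_image continuous_on_subset[OF f]) auto
  then obtain B where B: "\<And>x. x \<in> {0..1} \<Longrightarrow> \<bar>f x\<bar> \<le> B"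
    unfolding bounded_iff by (metis imageI real_norm_def)
  define g where "g = (\<lambda>x. f x + B)"
  have gpos: "g x \<ge> 0" if "x \<in> {0..1}" for x
    using B[OF that] by (auto simp: g_def)
  have gc: "continuous_on UNIV g" unfolding g_def by (intro continuous_intros f)
  note igs = integrable_cont[OF gc] integrable_cont[OF cont_S(1)[OF gc]] integrable_cont[OF cont_S(2)[OF gc]]
  have nn: "AE x in P. 0 \<le> g x" "AE x in P. 0 \<le> g (S1 r x)" "AE x in P. 0 \<le> g (S2 r x)"
    using AE_unit by (eventually_elim, use gpos S_maps in blast)+
  have [measurable]: "g \<in> borel_measurable borel"
    by (rule borel_measurable_continuous_onI[OF gc])
  have "2 * (\<integral>\<^sup>+x. ennreal (g x) \<partial>P)
      = (\<integral>\<^sup>+x. ennreal (g (S1 r x)) \<partial>P) + (\<integral>\<^sup>+x. ennreal (g (S2 r x)) \<partial>P)"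
    by (rule nn_integral_self) measurable
  then have "2 * ennreal (mean g) = ennreal (mean (\<lambda>x. g (S1 r x))) + ennreal (mean (\<lambda>x. g (S2 r x)))"
    unfolding nn_integral_eq_integral[OF igs(1) nn(1)] nn_integral_eq_integral[OF igs(2) nn(2)]
      nn_integral_eq_integral[OF igs(3) nn(3)] .
  then have "ennreal (2 * mean g) = ennreal (mean (\<lambda>x. g (S1 r x)) + mean (\<lambda>x. g (S2 r x)))"
    by (simp add: ennreal_mult' integral_nonneg_AE nn flip: ennreal_plus)
  then have "2 * mean g = mean (\<lambda>x. g (S1 r x)) + mean (\<lambda>x. g (S2 r x))"
    by (subst (asm) ennreal_inj) (auto intro!: add_nonneg_nonneg integral_nonneg_AE nn)
  moreover have "mean g = mean f + B" "mean (\<lambda>x. g (S1 r x)) = mean (\<lambda>x. f (S1 r x)) + B"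
      "mean (\<lambda>x. g (S2 r x)) = mean (\<lambda>x. f (S2 r x)) + B"
    unfolding g_def
    by (simp_all add: integrable_cont f cont_S prob_space)
  ultimately show ?thesis by simp
qed

lemma mean_mono:
  assumes "continuous_on UNIV f" "continuous_on UNIV g" "\<And>x. x \<in> {0..1} \<Longrightarrow> f x \<le> g x"
  shows "mean f \<le> mean g"
  using assms(3)
  by (intro integral_mono_AE integrable_cont assms(1,2) eventually_mono[OF AE_unit]) blast

lemma mean_cong:
  assumes "continuous_on UNIV f" "continuous_on UNIV g" "\<And>x. x \<in> {0..1} \<Longrightarrow> f x = g x"
  shows "mean f = mean g"
  by (intro antisym mean_mono) (use assms in auto)

lemma mean_id: "mean (\<lambda>x. x) = 1/2"
proof -
  have i: "integrable P (\<lambda>x. x)" by (rule integrable_cont) (intro continuous_intros)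
  have "mean (\<lambda>x. x) = (mean (\<lambda>x. r * x) + mean (\<lambda>x. r * x + 1 - r)) / 2"
    using mean_self[of "\<lambda>x. x"] by (simp add: S1_def S2_def)
  also have "\<dots> = r * mean (\<lambda>x. x) + (1 - r) / 2"
    using i by (simp add: prob_space field_simps)
  finally have "(1 - r) * mean (\<lambda>x. x) = (1 - r) * (1/2)" by (simp add: field_simps)
  then show ?thesis using r_half by (simp only: mult_cancel_left) auto
qed

text \<open>
The variance of the distribution; the mean is \<open>1/2\<close>.
\<close>

definition V :: real where "V = (1 - r) / (4 * (1 + r))"

lemma mean_second_moment: "mean (\<lambda>x. x^2) = V + 1/4"
proof -
  have i: "integrable P (\<lambda>x. x)" "integrable P (\<lambda>x. x^2)"
    by (rule integrable_cont, intro continuous_intros)+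
  have "mean (\<lambda>x. x^2) = (mean (\<lambda>x. r^2 * x^2) + mean (\<lambda>x. r^2 * x^2 + 2 * r * (1 - r) * x + (1 - r)^2)) / 2"
    using mean_self[of "\<lambda>x. x^2"]
    by (simp add: S1_def S2_def continuous_intros power2_eq_square algebra_simps)
  also have "\<dots> = r^2 * mean (\<lambda>x. x^2) + r * (1 - r) / 2 + (1 - r)^2 / 2"
    using i by (simp add: prob_space mean_id field_simps)
  finally have "(1 - r^2) * mean (\<lambda>x. x^2) = (1 - r) / 2"
    by (simp add: power2_eq_square field_simps)
  moreover have "(1 - r^2) * (V + 1/4) = (1 - r) / 2"
  proof -
    have "(1 - r^2) * (V + 1/4) = (1 - r) * ((1 + r) * (V + 1/4))"
      by (simp add: power2_eq_square algebra_simps)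
    also have "(1 + r) * (V + 1/4) = 1/2"
      using r_pos by (simp add: V_def field_simps)
    finally show ?thesis by simp
  qed
  moreover have "1 - r^2 \<noteq> 0" using r_pos r_half by (simp add: power2_eq_1_iff)
  ultimately show ?thesis by (metis mult_left_cancel)
qed

lemma mean_square: "mean (\<lambda>x. (x - a)^2) = V + (a - 1/2)^2"
proof -
  have i: "integrable P (\<lambda>x. x)" "integrable P (\<lambda>x. x^2)"
    by (rule integrable_cont, intro continuous_intros)+
  have "mean (\<lambda>x. (x - a)^2) = mean (\<lambda>x. x^2 - 2 * a * x + a^2)"
    by (simp add: power2_eq_square algebra_simps)
  also have "\<dots> = V + 1/4 - a + a^2"
    using i by (simp add: prob_space mean_id mean_second_moment)
  finally show ?thesis by (simp add: power2_eq_square algebra_simps)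
qed

definition avg :: "(real \<Rightarrow> real) \<Rightarrow> real \<Rightarrow> real" where
  "avg f = (\<lambda>x. (f (S1 r x) + f (S2 r x)) / 2)"

text \<open>
The averaging operator preserves the mean and commutes with the reflection \<open>x \<mapsto> 1 - x\<close>, and it
contracts differences by the factor \<open>r\<close>. After \<open>n\<close> steps the function is nearly constant, so its mean
and that of its reflection nearly agree. A uniformly continuous function is described here by an
additive error \<open>e\<close> plus a Lipschitz bound \<open>C\<close>: averaging leaves \<open>e\<close> alone and shrinks \<open>C\<close>.
\<close>

lemma mean_reflect:
  assumes f: "continuous_on UNIV f"
  shows "mean (\<lambda>x. f (1 - x)) = mean f"
proof -
  have c': "continuous_on UNIV (\<lambda>x. g (1 - x))" if "continuous_on UNIV g" for g :: "real \<Rightarrow> real"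
    by (rule continuous_on_compose2[OF that]) (auto intro!: continuous_intros)
  have main: "\<bar>mean (\<lambda>x. g (1 - x)) - mean g\<bar> \<le> e + r^n * C"
    if "continuous_on UNIV g" "C \<ge> 0"
      "\<And>x y. x \<in> {0..1} \<Longrightarrow> y \<in> {0..1} \<Longrightarrow> \<bar>g x - g y\<bar> \<le> e + C * \<bar>x - y\<bar>" for g C e n
    using that
  proof (induction n arbitrary: g C)
    case 0
    note c = 0(1) c'[OF 0(1)]
    have "\<bar>mean (\<lambda>x. g (1 - x)) - mean g\<bar> = \<bar>mean (\<lambda>x. g (1 - x) - g x)\<bar>"
      by (simp add: integrable_cont c)
    also have "\<dots> \<le> mean (\<lambda>x. \<bar>g (1 - x) - g x\<bar>)" by (rule integral_abs_bound)
    also have "\<dots> \<le> mean (\<lambda>x. e + C)"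
    proof (rule mean_mono)
      fix x :: real assume x: "x \<in> {0..1}"
      have "\<bar>g (1 - x) - g x\<bar> \<le> e + C * \<bar>1 - x - x\<bar>" by (rule 0) (use x in auto)
      also have "\<dots> \<le> e + C * 1" using x 0(2) by (intro add_left_mono mult_left_mono) auto
      finally show "\<bar>g (1 - x) - g x\<bar> \<le> e + C" by simp
    qed (auto intro!: continuous_intros c)
    finally show ?case by (simp add: prob_space)
  next
    case (Suc n)
    have e: "mean g = mean (avg g)" if "continuous_on UNIV g" for g
      using mean_self[OF that] cont_S[OF that] by (simp add: avg_def integrable_cont)
    note c = Suc.prems(1)
    have "avg (\<lambda>x. g (1 - x)) = (\<lambda>x. avg g (1 - x))"
      by (simp add: fun_eq_iff avg_def S1_def S2_def algebra_simps)
    then have "\<bar>mean (\<lambda>x. g (1 - x)) - mean g\<bar> = \<bar>mean (\<lambda>x. avg g (1 - x)) - mean (avg g)\<bar>"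
      using e[OF c] e[OF c'[OF c]] by simp
    also have "\<dots> \<le> e + r^n * (r * C)"
    proof (rule Suc.IH)
      show "continuous_on UNIV (avg g)" unfolding avg_def by (intro continuous_intros cont_S c) simp
      show "0 \<le> r * C" using Suc.prems(2) r_pos by simp
      fix x y :: real assume xy: "x \<in> {0..1}" "y \<in> {0..1}"
      have d: "\<bar>S1 r x - S1 r y\<bar> = r * \<bar>x - y\<bar>" "\<bar>S2 r x - S2 r y\<bar> = r * \<bar>x - y\<bar>"
        using r_pos by (simp_all add: S1_def S2_def abs_mult flip: right_diff_distrib)
      show "\<bar>avg g x - avg g y\<bar> \<le> e + (r * C) * \<bar>x - y\<bar>"
        using Suc.prems(3)[OF S_maps(1) S_maps(1), OF xy] Suc.prems(3)[OF S_maps(2) S_maps(2), OF xy]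
        unfolding d avg_def by (simp add: field_simps)
    qed
    finally show ?case by (simp add: ac_simps)
  qed
  have "\<bar>mean (\<lambda>x. f (1 - x)) - mean f\<bar> \<le> e" if e: "e > 0" for e
  proof -
    have cf: "continuous_on {0..1} f" by (rule continuous_on_subset[OF f]) simp
    have "uniformly_continuous_on {0..1} f"
      by (rule compact_uniformly_continuous[OF cf]) simp
    then obtain d where d: "d > 0"
      "\<And>x y. x \<in> {0..1} \<Longrightarrow> y \<in> {0..1} \<Longrightarrow> dist x y < d \<Longrightarrow> dist (f x) (f y) < e"
      using e unfolding uniformly_continuous_on_def by metis
    have "bounded (f ` {0..1})"
      by (intro compact_imp_bounded compact_continuous_image cf) auto
    then obtain B where B: "\<And>x. x \<in> {0..1} \<Longrightarrow> \<bar>f x\<bar> \<le> B"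
      unfolding bounded_iff by (metis imageI real_norm_def)
    have "B \<ge> 0" using B[of 0] by auto
    define C where "C = 2 * B / d"
    have C: "C \<ge> 0" using \<open>B \<ge> 0\<close> d by (simp add: C_def)
    have b: "\<bar>f x - f y\<bar> \<le> e + C * \<bar>x - y\<bar>" if xy: "x \<in> {0..1}" "y \<in> {0..1}" for x y
    proof (cases "\<bar>x - y\<bar> < d")
      case True
      then show ?thesis using d(2)[OF xy] C by (auto simp: dist_real_def intro: add_increasing2)
    next
      case False
      have "\<bar>f x - f y\<bar> \<le> 2 * B" using B[OF xy(1)] B[OF xy(2)] by linarith
      also have "\<dots> = C * d" using d by (simp add: C_def)
      also have "\<dots> \<le> C * \<bar>x - y\<bar>" using False C by (intro mult_left_mono) auto
      finally show ?thesis using e by simp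
    qed
    have "(\<lambda>n. e + r^n * C) \<longlonglongrightarrow> e + 0 * C"
      using r_pos r_half by (intro tendsto_intros LIMSEQ_power_zero) auto
    then have "(\<lambda>n. e + r^n * C) \<longlonglongrightarrow> e" by simp
    then show ?thesis
      by (rule LIMSEQ_le_const) (use main[OF f C b] in auto)
  qed
  then have "\<bar>mean (\<lambda>x. f (1 - x)) - mean f\<bar> \<le> 0" by (rule field_le_epsilon[of _ 0, simplified])
  then show ?thesis by simp
qed

text \<open>
Using the reflected second similarity \<open>x \<mapsto> 1 - r x\<close> puts the two halves of the Cantor set in mirror
position: in both of them the other half lies to the right, beyond \<open>1\<close>.
\<close>

lemma mean_split:
  assumes f: "continuous_on UNIV f"
  shows "mean f = (mean (\<lambda>x. f (r * x)) + mean (\<lambda>x. f (1 - r * x))) / 2"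
proof -
  have "mean (\<lambda>x. f (S2 r (1 - x))) = mean (\<lambda>x. f (S2 r x))"
    by (rule mean_reflect[OF cont_S(2)[OF f]])
  moreover have "S2 r (1 - x) = 1 - r * x" for x by (simp add: S2_def algebra_simps)
  ultimately show ?thesis using mean_self[OF f] by (simp add: S1_def)
qed

end

section \<open>Squared distance to a finite set\<close>

definition dmin :: "real set \<Rightarrow> real \<Rightarrow> real" where
  "dmin A x = Min ((\<lambda>a. (x - a)^2) ` A)"

lemma distortion_dmin: "distortion P A = integral\<^sup>L P (dmin A)"
  by (simp add: distortion_def dmin_def[abs_def])

lemma dmin_le: "finite A \<Longrightarrow> a \<in> A \<Longrightarrow> dmin A x \<le> (x - a)^2"
  by (simp add: dmin_def)

lemma dmin_ge_iff:
  "finite A \<Longrightarrow> A \<noteq> {} \<Longrightarrow> c \<le> dmin A x \<longleftrightarrow> (\<forall>a\<in>A. c \<le> (x - a)^2)"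
  by (simp add: dmin_def)

lemma dmin_nonneg: "finite A \<Longrightarrow> A \<noteq> {} \<Longrightarrow> 0 \<le> dmin A x"
  by (simp add: dmin_ge_iff)

lemma dmin_attained:
  assumes "finite A" "A \<noteq> {}"
  obtains a where "a \<in> A" "dmin A x = (x - a)^2"
proof -
  have "dmin A x \<in> (\<lambda>a. (x - a)^2) ` A"
    unfolding dmin_def using assms by (intro Min_in) auto
  then show ?thesis using that by blast
qed

lemma dmin_antimono:
  "finite B \<Longrightarrow> A \<noteq> {} \<Longrightarrow> A \<subseteq> B \<Longrightarrow> dmin B x \<le> dmin A x"
  unfolding dmin_def by (rule Min_antimono) auto

lemma dmin_singleton [simp]: "dmin {a} x = (x - a)^2"
  by (simp add: dmin_def)

lemma dmin_insert:
  "finite A \<Longrightarrow> A \<noteq> {} \<Longrightarrow> dmin (insert s A) x = min ((x - s)^2) (dmin A x)"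
  by (simp add: dmin_def)

lemma continuous_dmin:
  assumes "finite A" "A \<noteq> {}"
  shows "continuous_on UNIV (dmin A)"
  using assms
proof (induction rule: finite_ne_induct)
  case (singleton a)
  show ?case by (simp add: dmin_def[abs_def] continuous_intros)
next
  case (insert a A)
  have "dmin (insert a A) = (\<lambda>x. min ((x - a)^2) (dmin A x))"
    using insert by (simp add: dmin_insert fun_eq_iff)
  then show ?case using insert by (auto intro!: continuous_intros)
qed

lemma dmin_affine:
  assumes "finite A" "A \<noteq> {}" "u \<noteq> 0"
  shows "dmin A (u * x + v) = u^2 * dmin ((\<lambda>a. (a - v) / u) ` A) x"
proof (rule antisym)
  let ?B = "(\<lambda>a. (a - v) / u) ` A"
  have e: "(u * x + v - a)^2 = u^2 * (x - (a - v) / u)^2" for a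
    using assms(3) by (simp add: field_simps flip: power_mult_distrib)
  have B: "finite ?B" "?B \<noteq> {}" using assms by auto
  obtain b where b: "b \<in> ?B" "dmin ?B x = (x - b)^2" using dmin_attained[OF B] by blast
  then show "dmin A (u * x + v) \<le> u^2 * dmin ?B x"
    using dmin_le[OF assms(1)] by (auto simp flip: e)
  show "u^2 * dmin ?B x \<le> dmin A (u * x + v)"
    using assms(1,2) dmin_le[OF B(1)] by (auto simp: dmin_ge_iff e intro!: mult_left_mono)
qed


section \<open>The tail function and its chords\<close>

context cantor
begin

text \<open>
The tail function plays the role of a distribution function: all costs of one-dimensional codebooks
are linear in its values at the midpoints of neighbouring points.
\<close>

definition psi :: "real \<Rightarrow> real" where
  "psi b = mean (\<lambda>x. max 0 (x - b))"

lemma cont_max: "continuous_on UNIV (\<lambda>x::real. max 0 (x - b))"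
  by (intro continuous_intros)

lemma psi_eq_0: "b \<ge> 1 \<Longrightarrow> psi b = 0"
proof -
  assume "b \<ge> 1"
  then have "psi b = mean (\<lambda>x. 0)"
    unfolding psi_def by (intro mean_cong cont_max) auto
  then show ?thesis by simp
qed

lemma psi_linear: "b \<le> 0 \<Longrightarrow> psi b = 1/2 - b"
proof -
  assume "b \<le> 0"
  then have "psi b = mean (\<lambda>x. x - b)"
    unfolding psi_def by (intro mean_cong cont_max) (auto intro!: continuous_intros)
  also have "\<dots> = 1/2 - b"
    using mean_id integrable_cont[of "\<lambda>x. x"] by (simp add: prob_space)
  finally show ?thesis .
qed

lemma psi_self: "psi b = r / 2 * (psi (b / r) + psi ((b - 1 + r) / r))"
proof -
  have 1: "max 0 (S1 r x - b) = r * max 0 (x - b / r)" for x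
    using r_pos by (simp add: S1_def max_def field_simps)
  have 2: "max 0 (S2 r x - b) = r * max 0 (x - (b - 1 + r) / r)" for x
    using r_pos by (simp add: S2_def max_def field_simps)
  show ?thesis
    unfolding psi_def by (subst mean_self[OF cont_max]) (simp add: 1 2 algebra_simps)
qed

lemma psi_left: "b \<le> 1 - r \<Longrightarrow> psi b = r / 2 * psi (b / r) + (1 - r/2 - b) / 2"
  using psi_self[of b] psi_linear[of "(b - 1 + r) / r"] r_pos
  by (simp add: divide_le_0_iff field_simps)

lemma psi_right: "b \<ge> r \<Longrightarrow> psi b = r / 2 * psi ((b - 1 + r) / r)"
  using psi_self[of b] psi_eq_0[of "b / r"] r_pos by simp

lemma psi_le_chord: "0 \<le> b \<Longrightarrow> b \<le> 1 \<Longrightarrow> psi b \<le> (1 - b) / 2"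
proof -
  assume b: "0 \<le> b" "b \<le> 1"
  have "psi b \<le> mean (\<lambda>x. x * (1 - b))"
    unfolding psi_def
  proof (intro mean_mono cont_max)
    fix x :: real assume x: "x \<in> {0..1}"
    have "0 \<le> x * (1 - b)" using x b by simp
    moreover have "0 \<le> b * (1 - x)" using x b by simp
    then have "x - b \<le> x * (1 - b)" by (simp add: algebra_simps)
    ultimately show "max 0 (x - b) \<le> x * (1 - b)" by simp
  qed (intro continuous_intros)
  also have "\<dots> = (1 - b) / 2" by (simp add: mean_id)
  finally show ?thesis .
qed

lemma cost_two:
  assumes "t \<le> s"
  shows "mean (dmin {t, s}) = V + (t - 1/2)^2 - 2 * (s - t) * psi ((s + t) / 2)"
proof -
  have eq: "dmin {t, s} x = (x - t)^2 - 2 * (s - t) * max 0 (x - (s + t) / 2)" for x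
  proof -
    have d: "dmin {t, s} x = min ((x - t)^2) ((x - s)^2)" by (simp add: dmin_insert)
    have e: "(x - s)^2 = (x - t)^2 - 2 * (s - t) * (x - (s + t) / 2)"
      by (simp add: power2_eq_square field_simps)
    show ?thesis
    proof (cases "x \<le> (s + t) / 2")
      case True
      then have "2 * (s - t) * (x - (s + t) / 2) \<le> 0"
        using assms by (intro mult_nonneg_nonpos) auto
      then show ?thesis using True by (simp add: d e)
    next
      case False
      then have "2 * (s - t) * (x - (s + t) / 2) \<ge> 0" using assms by simp
      then show ?thesis using False by (simp add: d e)
    qed
  qed
  have i: "integrable P (\<lambda>x. (x - t)^2)"
    "integrable P (\<lambda>x. 2 * (s - t) * max 0 (x - (s + t) / 2))"
    by (rule integrable_cont, intro continuous_intros)+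
  have "mean (dmin {t, s}) = mean (\<lambda>x. (x - t)^2 - 2 * (s - t) * max 0 (x - (s + t) / 2))"
    using eq by presburger
  also have "\<dots> = V + (t - 1/2)^2 - 2 * (s - t) * psi ((s + t) / 2)"
    using i by (simp add: mean_square psi_def)
  finally show ?thesis .
qed

end

datatype ctree = Leaf | Node ctree ctree

text \<open>
The tail function is convex, so it lies below the interpolating polygon through any finite set of
its values. Its exact values at the end points of the basic intervals are available from
self-similarity. A tree selects the basic intervals used; a pair \<open>(p, h)\<close> stands for the line
\<open>b \<mapsto> h + p (1/2 - b)\<close>. A leaf contributes the chord over its interval, namely \<open>(1/2, 1/4)\<close> in the
coordinates of the interval, together with the two lines that extend the function exactly to both
sides.
\<close>

fun chords :: "real \<Rightarrow> ctree \<Rightarrow> (real \<times> real) list" where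
  "chords r Leaf = [(0, 0), (1/2, 1/4), (1, 0)]"
| "chords r (Node s t) =
     map (\<lambda>(p, h). ((1 + p) / 2, r * h / 2 + (1 - p) * (1 - r) / 4)) (chords r s)
   @ map (\<lambda>(p, h). (p / 2, r * h / 2 + p * (1 - r) / 4)) (chords r t)"

lemma (in cantor) psi_le_chords:
  "\<exists>(p, h) \<in> set (chords r T). psi b \<le> h + p * (1/2 - b)"
proof (induction T arbitrary: b)
  case Leaf
  consider "b \<le> 0" | "0 \<le> b" "b \<le> 1" | "1 \<le> b" by linarith
  then show ?case
  proof cases
    case 1 then show ?thesis using psi_linear[of b] by simp
  next
    case 2 then show ?thesis using psi_le_chord[of b] by (simp add: field_simps)
  next
    case 3 then show ?thesis using psi_eq_0[of b] by simp
  qed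
next
  case (Node s t)
  show ?case
  proof (cases "b \<le> 1 - r")
    case True
    obtain p h where ph: "(p, h) \<in> set (chords r s)" "psi (b / r) \<le> h + p * (1/2 - b / r)"
      using Node.IH(1)[of "b / r"] by auto
    have "psi b \<le> r / 2 * (h + p * (1/2 - b / r)) + (1 - r/2 - b) / 2"
      using ph(2) r_pos by (simp add: psi_left[OF True] mult_left_mono)
    also have "\<dots> = r * h / 2 + (1 - p) * (1 - r) / 4 + (1 + p) / 2 * (1/2 - b)"
      using r_pos by (simp add: field_simps)
    finally show ?thesis using ph(1) by force
  next
    case False
    then have b: "r \<le> b" using r_half by simp
    obtain p h where ph: "(p, h) \<in> set (chords r t)"
        "psi ((b - 1 + r) / r) \<le> h + p * (1/2 - (b - 1 + r) / r)"
      using Node.IH(2)[of "(b - 1 + r) / r"] by auto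
    have "psi b \<le> r / 2 * (h + p * (1/2 - (b - 1 + r) / r))"
      using ph(2) r_pos by (simp add: psi_right[OF b] mult_left_mono)
    also have "\<dots> = r * h / 2 + p * (1 - r) / 4 + p / 2 * (1/2 - b)"
      using r_pos by (simp add: field_simps)
    finally show ?thesis using ph(1) by force
  qed
qed

lemma chords_nonneg:
  assumes "(p, h) \<in> set (chords r T)" "0 \<le> r" "r \<le> 1"
  shows "0 \<le> p" "p \<le> 1" "0 \<le> h"
proof -
  have "0 \<le> p \<and> p \<le> 1 \<and> 0 \<le> h"
    using assms
  proof (induction T arbitrary: p h)
    case (Node s t)
    from Node.prems(1) consider
        p' h' where "(p', h') \<in> set (chords r s)" "p = (1 + p') / 2" "h = r * h' / 2 + (1 - p') * (1 - r) / 4"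
      | p' h' where "(p', h') \<in> set (chords r t)" "p = p' / 2" "h = r * h' / 2 + p' * (1 - r) / 4"
      by auto
    then show ?case
    proof cases
      case 1
      then show ?thesis using Node.IH(1)[OF 1(1)] Node.prems by (auto intro!: add_nonneg_nonneg)
    next
      case 2
      then show ?thesis using Node.IH(2)[OF 2(1)] Node.prems by (auto intro!: add_nonneg_nonneg)
    qed
  qed auto
  then show "0 \<le> p" "p \<le> 1" "0 \<le> h" by auto
qed

text \<open>
The point \<open>t\<close> and the point \<open>s\<close> have decoupled here: for a fixed chord the bound is a quadratic
polynomial in each of them. If the chord is one of the exact lines, \<open>p\<close> is the mass served by \<open>s\<close>.
\<close>

lemma (in cantor) cost_two_ge_chord:
  assumes "t \<le> s"
  obtains p h where "(p, h) \<in> set (chords r T)"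
    "mean (dmin {t, s}) \<ge> V + (1 - p) * (1/2 - t)^2 - 2 * h * (1/2 - t) + p * (s - 1/2)^2 - 2 * h * (s - 1/2)"
proof -
  obtain p h where ph: "(p, h) \<in> set (chords r T)" "psi ((s + t) / 2) \<le> h + p * (1/2 - (s + t) / 2)"
    using psi_le_chords[of T "(s + t) / 2"] by auto
  have "2 * (s - t) * psi ((s + t) / 2) \<le> 2 * (s - t) * (h + p * (1/2 - (s + t) / 2))"
    using ph(2) assms by (intro mult_left_mono) auto
  then have "mean (dmin {t, s}) \<ge> V + (t - 1/2)^2 - 2 * (s - t) * (h + p * (1/2 - (s + t) / 2))"
    unfolding cost_two[OF assms] by linarith
  also have "V + (t - 1/2)^2 - 2 * (s - t) * (h + p * (1/2 - (s + t) / 2))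
      = V + (1 - p) * (1/2 - t)^2 - 2 * h * (1/2 - t) + p * (s - 1/2)^2 - 2 * h * (s - 1/2)"
    by (simp add: power2_eq_square field_simps)
  finally show ?thesis using that ph(1) by blast
qed

section \<open>Certified numerical bounds for the chords\<close>

text \<open>
Division rounded upwards, for fixed-point arithmetic that stays on the safe side.
\<close>

definition cdiv :: "int \<Rightarrow> int \<Rightarrow> int" where
  "cdiv a b = - ((- a) div b)"

lemma cdiv_ge: "real_of_int a / real_of_int b \<le> real_of_int (cdiv a b)"
proof -
  have "real_of_int ((- a) div b) \<le> real_of_int (- a) / real_of_int b"
    by (metis floor_divide_of_int_eq of_int_floor_le)
  then show ?thesis by (simp add: cdiv_def)
qed

text \<open>
The chords again, for ratios between \<open>0.435041170\<close> and \<open>0.435041171\<close>: an entry \<open>(P, d, H)\<close> has slope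
exactly \<open>P / 2^d\<close> and an offset of at most \<open>H / 10^9\<close>.
\<close>

fun ichords :: "ctree \<Rightarrow> (int \<times> nat \<times> int) list" where
  "ichords Leaf = [(0, 0, 0), (1, 1, 250000000), (1, 0, 0)]"
| "ichords (Node s t) =
     map (\<lambda>(P, d, H). (2^d + P, Suc d,
        cdiv (435041171 * H) 2000000000 + cdiv ((2^d - P) * 564958830) (4 * 2^d))) (ichords s)
   @ map (\<lambda>(P, d, H). (P, Suc d,
        cdiv (435041171 * H) 2000000000 + cdiv (P * 564958830) (4 * 2^d))) (ichords t)"

text \<open>
The polygon has to be fine where the two-pair inequality is nearly sharp. That happens for chords
of slope slightly above \<open>1/4\<close>, where a margin of a few millionths remains; elsewhere a coarse
subdivision is enough.
\<close>

definition refinement :: ctree where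
  "refinement =
    Node
      (Node Leaf Leaf)
      (Node
        (Node Leaf
          (Node Leaf
            (Node (Node Leaf Leaf) (Node Leaf Leaf))))
        (Node
          (Node Leaf Leaf)
          (Node Leaf (Node Leaf Leaf))))"



text \<open>
For a pair of chords, the sum of the two bounds is a quadratic polynomial in the position of the
point that both pairs share. The test says that its discriminant is not positive, with slopes
scaled by \<open>128\<close> and all other quantities by \<open>10^9\<close>. The constant \<open>1298633018\<close> is \<open>1/r - 1\<close> rounded down, and
\<open>79794500\<close> is \<open>V (1 - r^2)\<close> reduced by about \<open>10^-7\<close> to absorb the rounding of \<open>1/r\<close>. The third component
of a vertex is an upper bound of \<open>h^2 / (1 - p)\<close>, the largest amount that the choice of the unshared
point can save.
\<close>

definition pair_ok :: "int \<times> int \<times> int \<Rightarrow> int \<times> int \<times> int \<Rightarrow> bool" where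
  "pair_ok = (\<lambda>(P, H, A) (Q, K, B).
     (Q * 1298633018 + 128 * (H - K))^2
       \<le> (P + Q) * (Q * 1298633018^2 - 256 * K * 1298633018 + 128 * 1000000000 * (79794500 - A - B)))"

definition vertices :: "(int \<times> int \<times> int) list" where
  "vertices = map (\<lambda>(P, H). (P, H, cdiv (128 * H^2) (1000000000 * (128 - P))))
     (remdups (map (\<lambda>(P, d, H). (P * 2^(7 - d), H)) (ichords refinement)))"

text \<open>
The exempted pairs are those of slopes \<open>(0, 0)\<close>, \<open>(0, 1/2)\<close> and \<open>(1/4, 1/4)\<close>. The latter two are the
configurations in which equality holds at the critical ratio, so rounding is not permitted there,
and for the first one the polynomial degenerates.
\<close>

definition pairs_ok :: "(int \<times> int \<times> int) list \<Rightarrow> bool" where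
  "pairs_ok xs = list_all (\<lambda>(P, H, A). list_all (\<lambda>(Q, K, B).
       Q < P \<or> (P = 32 \<and> Q = 32) \<or> (P = 0 \<and> (Q = 0 \<or> Q = 64))
         \<or> pair_ok (P, H, A) (Q, K, B)) xs) xs"

text \<open>
This finite computation replaces a case distinction over the intervals in which the two cell
boundaries lie.
\<close>

lemma pairs_ok_vertices: "pairs_ok vertices"
  by code_simp

lemma ichords_range:
  "list_all (\<lambda>(P, d, H). d \<le> 7 \<and> (P = 2^d \<longrightarrow> H = 0) \<and> H \<le> 1000000000) (ichords refinement)"
  by code_simp

lemma chords_le_ichords:
  assumes r: "435041170 / 10^9 \<le> r" "r \<le> 435041171 / 10^9"
    and "(p, h) \<in> set (chords r T)"
  shows "\<exists>(P, d, H) \<in> set (ichords T). p = real_of_int P / 2^d \<and> h \<le> real_of_int H / 10^9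
           \<and> 0 \<le> P \<and> P \<le> 2^d"
  using assms(3)
proof (induction T arbitrary: p h)
  case Leaf
  then show ?case by auto
next
  case (Node s t)
  have a: "r * h / 2 + x * (1 - r) / 4
      \<le> real_of_int (cdiv (435041171 * H) 2000000000 + cdiv (X * 564958830) (4 * 2^d)) / 10^9"
    if "0 \<le> h" "h \<le> real_of_int H / 10^9" "0 \<le> X" "x = real_of_int X / 2^d" for h x H X d
  proof -
    have "r * h / 2 \<le> (435041171 / 10^9) * (real_of_int H / 10^9) / 2"
      using that r by (intro divide_right_mono mult_mono) auto
    also have "\<dots> = (real_of_int (435041171 * H) / real_of_int 2000000000) / 10^9" by simp
    also have "\<dots> \<le> real_of_int (cdiv (435041171 * H) 2000000000) / 10^9"
      by (intro divide_right_mono cdiv_ge) auto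
    finally have 1: "r * h / 2 \<le> real_of_int (cdiv (435041171 * H) 2000000000) / 10^9" .
    have "x * (1 - r) / 4 \<le> (real_of_int X / 2^d) * (564958830 / 10^9) / 4"
      unfolding that(4) using that(3) r by (intro divide_right_mono mult_left_mono) auto
    also have "\<dots> = (real_of_int (X * 564958830) / real_of_int (4 * 2^d)) / 10^9" by simp
    also have "\<dots> \<le> real_of_int (cdiv (X * 564958830) (4 * 2^d)) / 10^9"
      by (intro divide_right_mono cdiv_ge) auto
    finally show ?thesis using 1 by simp
  qed
  have r01: "0 \<le> r" "r \<le> 1" using r by auto
  from Node.prems consider
      p' h' where "(p', h') \<in> set (chords r s)" "p = (1 + p') / 2" "h = r * h' / 2 + (1 - p') * (1 - r) / 4"
    | p' h' where "(p', h') \<in> set (chords r t)" "p = p' / 2" "h = r * h' / 2 + p' * (1 - r) / 4"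
    by auto
  then show ?case
  proof cases
    case 1
    obtain P d H where *: "(P, d, H) \<in> set (ichords s)" "p' = real_of_int P / 2^d"
        "h' \<le> real_of_int H / 10^9" "0 \<le> P" "P \<le> 2^d"
      using Node.IH(1)[OF 1(1)] by auto
    let ?H = "cdiv (435041171 * H) 2000000000 + cdiv ((2^d - P) * 564958830) (4 * 2^d)"
    have "1 - p' = real_of_int (2^d - P) / 2^d" by (simp add: * field_simps)
    then have "h \<le> real_of_int ?H / 10^9"
      unfolding 1(3) using * chords_nonneg(3)[OF 1(1) r01] by (intro a) auto
    moreover have "(2^d + P, Suc d, ?H) \<in> set (ichords (Node s t))" using *(1) by force
    moreover have "p = real_of_int (2^d + P) / 2^Suc d" by (simp add: 1(2) *(2) field_simps)
    moreover have "0 \<le> 2^d + P" "2^d + P \<le> 2^Suc d" using * by auto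
    ultimately show ?thesis by blast
  next
    case 2
    obtain P d H where *: "(P, d, H) \<in> set (ichords t)" "p' = real_of_int P / 2^d"
        "h' \<le> real_of_int H / 10^9" "0 \<le> P" "P \<le> 2^d"
      using Node.IH(2)[OF 2(1)] by auto
    let ?H = "cdiv (435041171 * H) 2000000000 + cdiv (P * 564958830) (4 * 2^d)"
    have "h \<le> real_of_int ?H / 10^9"
      unfolding 2(3) using * chords_nonneg(3)[OF 2(1) r01] by (intro a) auto
    moreover have "(P, Suc d, ?H) \<in> set (ichords (Node s t))" using *(1) by force
    moreover have "p = real_of_int P / 2^Suc d" by (simp add: 2(2) *(2))
    moreover have "P \<le> 2^Suc d" using *(4,5) by simp
    ultimately show ?thesis using *(4) by blast
  qed
qed

lemma quadratic_nonneg: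
  fixes a b c x :: real
  assumes "a > 0" "b^2 \<le> a * c"
  shows "a * x^2 - 2 * b * x + c \<ge> 0"
proof -
  have "a * (a * x^2 - 2 * b * x + c) = (a * x - b)^2 + (a * c - b^2)"
    by (simp add: power2_eq_square algebra_simps)
  also have "\<dots> \<ge> 0" using assms(2) by simp
  finally show ?thesis using assms(1) by (simp add: zero_le_mult_iff)
qed

lemma chords_le_vertices:
  assumes r: "435041170 / 10^9 \<le> r" "r \<le> 435041171 / 10^9"
    and ph: "(p, h) \<in> set (chords r refinement)"
  obtains P H A where "(P, H, A) \<in> set vertices" "p = real_of_int P / 128"
    "h \<le> real_of_int H / 10^9" "0 \<le> P" "H \<le> 10^9"
    "\<And>x. (1 - p) * x^2 - 2 * (real_of_int H / 10^9) * x \<ge> - real_of_int A / 10^9"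
proof -
  from chords_le_ichords[OF r ph] obtain P d H where *:
    "(P, d, H) \<in> set (ichords refinement)" "p = real_of_int P / 2^d" "h \<le> real_of_int H / 10^9"
    "0 \<le> P" "P \<le> 2^d" by auto
  have d: "d \<le> 7" "P = 2^d \<longrightarrow> H = 0" "H \<le> 1000000000"
    using ichords_range *(1) by (auto simp: list_all_iff)
  define P' where "P' = P * 2^(7 - d)"
  define A where "A = cdiv (128 * H^2) (1000000000 * (128 - P'))"
  have pw: "2^d * 2^(7 - d) = (128::'a::comm_semiring_1)"
    using d(1) by (simp flip: power_add)
  have p: "p = real_of_int P' / 128"
  proof -
    have "p = real_of_int P * 2^(7 - d) / (2^d * 2^(7 - d))" by (simp add: *(2))
    then show ?thesis by (simp add: pw P'_def)
  qed
  have "(P', H) \<in> set (map (\<lambda>(P, d, H). (P * 2^(7 - d), H)) (ichords refinement))"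
    using *(1) by (force simp: P'_def)
  then have "(P', H, A) \<in> set vertices" by (force simp: vertices_def A_def)
  moreover have "P' \<ge> 0" using *(4) by (simp add: P'_def)
  moreover have "(1 - p) * x^2 - 2 * (real_of_int H / 10^9) * x \<ge> - real_of_int A / 10^9" for x
  proof (cases "P = 2^d")
    case True
    then show ?thesis using d(2) *(2) by (simp add: A_def cdiv_def)
  next
    case False
    have P'less: "P' < 128"
    proof -
      have "P < 2^d" using False *(5) by simp
      then have "P' < 2^d * 2^(7 - d)" unfolding P'_def by (intro mult_strict_right_mono) auto
      then show ?thesis by (simp add: pw)
    qed
    have ge: "128 * real_of_int H ^ 2 / (1000000000 * (128 - real_of_int P')) \<le> real_of_int A"
      using cdiv_ge[of "128 * H^2" "1000000000 * (128 - P')"] by (simp add: A_def)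
    have pos: "128 - real_of_int P' > 0" using P'less by simp
    have "(real_of_int H / 10^9)^2 = (1 - p) * (128 * real_of_int H ^ 2 / (1000000000 * (128 - real_of_int P')) / 10^9)"
      using pos by (simp add: p field_simps power2_eq_square)
    also have "\<dots> \<le> (1 - p) * (real_of_int A / 10^9)"
      using pos ge by (intro mult_left_mono divide_right_mono) (auto simp: p)
    finally have "(1 - p) * x^2 - 2 * (real_of_int H / 10^9) * x + real_of_int A / 10^9 \<ge> 0"
      using pos by (intro quadratic_nonneg) (auto simp: p)
    then show ?thesis by simp
  qed
  ultimately show ?thesis using that p *(3) d(3) by auto
qed

lemma pair_ok_bound:
  fixes P H A Q K B :: int
  defines "p \<equiv> real_of_int P / 128" and "q \<equiv> real_of_int Q / 128"
    and "h \<equiv> real_of_int H / 10^9" and "k \<equiv> real_of_int K / 10^9"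
    and "S \<equiv> 1298633018 / 10^9 :: real"
  assumes ok: "pair_ok (P, H, A) (Q, K, B)" and pos: "0 < P + Q"
  shows "p * y^2 - 2 * h * y + q * (S - y)^2 - 2 * k * (S - y)
          - real_of_int A / 10^9 - real_of_int B / 10^9 + 79794500 / 10^9 \<ge> 0"
proof -
  let ?c = "q * S^2 - 2 * k * S - real_of_int A / 10^9 - real_of_int B / 10^9 + 79794500 / 10^9"
  have "real_of_int ((Q * 1298633018 + 128 * (H - K))^2)
     \<le> real_of_int ((P + Q) * (Q * 1298633018^2 - 256 * K * 1298633018 + 128 * 1000000000 * (79794500 - A - B)))"
    using ok unfolding pair_ok_def by (simp only: of_int_le_iff prod.case)
  then have "(q * S + h - k)^2 \<le> (p + q) * ?c"
    unfolding p_def q_def h_def k_def S_def by (simp add: field_simps power2_eq_square)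
  then have "(p + q) * y^2 - 2 * (q * S + h - k) * y + ?c \<ge> 0"
    using pos by (intro quadratic_nonneg) (auto simp: p_def q_def simp flip: add_divide_distrib of_int_add)
  then show ?thesis by (simp add: power2_eq_square algebra_simps)
qed


section \<open>The cost of the balanced codebook\<close>

text \<open>
Distributing the points as evenly as possible over the two halves of the Cantor set, recursively.
The parameters are the square of the ratio and the variance.
\<close>

function balanced_cost :: "real \<Rightarrow> real \<Rightarrow> nat \<Rightarrow> real" where
  "balanced_cost q v n =
     (if n \<le> 1 then v else q / 2 * (balanced_cost q v (n div 2) + balanced_cost q v ((n + 1) div 2)))"
  by auto
termination by (relation "Wellfounded.measure (\<lambda>(q, v, n). n)") auto

declare balanced_cost.simps [simp del]

context cantor
begin

abbreviation cost :: "real set \<Rightarrow> real" where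
  "cost A \<equiv> mean (dmin A)"

abbreviation D :: "nat \<Rightarrow> real" where
  "D \<equiv> balanced_cost (r^2) V"

text \<open>
What an additional point saves. Since gains decrease, the sequence of costs is convex, which is why
the even distribution is the best one.
\<close>

definition gain :: "nat \<Rightarrow> real" where
  "gain n = D n - D (Suc n)"

definition halves :: "nat \<Rightarrow> real" where
  "halves n = D (n div 2) + D ((n + 1) div 2)"

lemma D_1: "D 1 = V" "D (Suc 0) = V"
  by (simp_all add: balanced_cost.simps)

lemma D_halves: "n \<ge> 2 \<Longrightarrow> D n = r^2 / 2 * halves n"
  by (simp add: balanced_cost.simps[of _ _ n] halves_def)

lemma V_pos: "V > 0"
  using r_pos r_half by (simp add: V_def)

lemma V_identity: "V * (1 - r^2) = (1 - r)^2 / 4"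
proof -
  have "V * (1 - r^2) = V * (1 + r) * (1 - r)" by (simp add: power2_eq_square algebra_simps)
  also have "V * (1 + r) = (1 - r) / 4" using r_pos by (simp add: V_def field_simps)
  finally show ?thesis by (simp add: power2_eq_square)
qed

lemma D_2: "D 2 = r^2 * V"
  by (simp add: D_halves halves_def D_1)

lemma gain_1: "gain 1 = (1 - r)^2 / 4" "gain (Suc 0) = (1 - r)^2 / 4"
  using V_identity D_2 by (simp_all add: gain_def D_1 algebra_simps flip: numeral_2_eq_2)

lemma gain_rec: "n \<ge> 2 \<Longrightarrow> gain n = r^2 / 2 * gain (n div 2)"
proof -
  assume n: "n \<ge> 2"
  have "gain n = r^2 / 2 * (halves n - halves (Suc n))"
    using n by (simp add: gain_def D_halves algebra_simps)
  also have "halves n - halves (Suc n) = gain (n div 2)"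
    by (cases "even n") (auto simp: halves_def gain_def elim!: evenE oddE)
  finally show ?thesis .
qed

lemma gain_nonneg: "n \<ge> 1 \<Longrightarrow> gain n \<ge> 0"
proof (induction n rule: less_induct)
  case (less n)
  show ?case
  proof (cases "n = 1")
    case True
    then show ?thesis by (simp add: gain_1)
  next
    case False
    then have "n \<ge> 2" using less.prems by simp
    then show ?thesis using less.IH[of "n div 2"] by (simp add: gain_rec)
  qed
qed

lemma gain_Suc_le: "n \<ge> 1 \<Longrightarrow> gain (Suc n) \<le> gain n"
proof (induction n rule: less_induct)
  case (less n)
  have r2: "r^2 / 2 \<le> 1" using r_pos r_half power_le_one[of r 2] by simp
  show ?case
  proof (cases "n = 1")
    case True
    have "gain (Suc n) = r^2 / 2 * gain n" using True gain_rec[of "Suc n"] by simp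
    also have "\<dots> \<le> gain n" using r2 gain_nonneg[of n] True by (intro mult_left_le_one_le) auto
    finally show ?thesis .
  next
    case False
    then have n: "n \<ge> 2" using less.prems by simp
    have "gain (Suc n div 2) \<le> gain (n div 2)"
    proof (cases "even n")
      case False
      then have "Suc n div 2 = Suc (n div 2)" by presburger
      then show ?thesis using less.IH[of "n div 2"] n by simp
    qed simp
    then have "r^2 / 2 * gain (Suc n div 2) \<le> r^2 / 2 * gain (n div 2)"
      by (intro mult_left_mono) auto
    then show ?thesis using n gain_rec[of n] gain_rec[of "Suc n"] by linarith
  qed
qed

lemma gain_antimono: "1 \<le> m \<Longrightarrow> m \<le> n \<Longrightarrow> gain n \<le> gain m"
  by (rotate_tac, induction n rule: dec_induct) (auto intro: order_trans[OF gain_Suc_le])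

lemma D_Suc_le: "n \<ge> 1 \<Longrightarrow> D (Suc n) \<le> D n"
  using gain_nonneg[of n] by (simp add: gain_def)

lemma D_antimono: "1 \<le> m \<Longrightarrow> m \<le> n \<Longrightarrow> D n \<le> D m"
  by (rotate_tac, induction n rule: dec_induct) (auto intro: order_trans[OF D_Suc_le])

lemma halves_antimono: "2 \<le> m \<Longrightarrow> m \<le> n \<Longrightarrow> halves n \<le> halves m"
  unfolding halves_def by (intro add_mono D_antimono) auto

text \<open>
Moving a point from the larger group to the smaller one does not increase the sum, by convexity.
\<close>

lemma halves_le:
  assumes "i \<ge> 1" "j \<ge> 1"
  shows "halves (i + j) \<le> D i + D j"
proof -
  have "halves (i + j) \<le> D i + D j" if "1 \<le> i" "i \<le> j" for i j
    using that
  proof (induction "j - i" arbitrary: i j rule: less_induct)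
    case less
    show ?case
    proof (cases "j \<le> Suc i")
      case True
      then consider "j = i" | "j = Suc i" using less.prems by linarith
      then show ?thesis by cases (simp_all add: halves_def)
    next
      case False
      have "halves (Suc i + (j - 1)) \<le> D (Suc i) + D (j - 1)"
        using less False by (intro less.hyps) auto
      moreover have "gain (j - 1) \<le> gain i" using less.prems False by (intro gain_antimono) auto
      ultimately show ?thesis using False by (simp add: gain_def)
    qed
  qed
  from this[of i j] this[of j i] show ?thesis
    using assms by (cases "i \<le> j") (simp_all add: add.commute)
qed

section \<open>A helper point to the right of the support\<close>

text \<open>
How much a point at \<open>y\<close> profits if, beside a code point at \<open>m\<close>, another one at \<open>s\<close> becomes
available.
\<close>

definition pull :: "real \<Rightarrow> real \<Rightarrow> real \<Rightarrow> real" where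
  "pull m s y = max 0 ((y - m)^2 - (y - s)^2)"

definition benefit :: "real \<Rightarrow> real \<Rightarrow> real" where
  "benefit m s = mean (pull m s)"

lemma cont_pull: "continuous_on UNIV (pull m s)"
  unfolding pull_def[abs_def] by (intro continuous_intros)

lemma pull_nonneg: "pull m s y \<ge> 0"
  by (simp add: pull_def)

lemma min_pull: "min ((y - m)^2) ((y - s)^2) = (y - m)^2 - pull m s y"
  by (simp add: pull_def)

text \<open>
The point \<open>s\<close> is the nearer one exactly to the right of the midpoint.
\<close>

lemma square_diff_le_iff:
  fixes y m s :: real
  assumes "m < s" shows "(y - s)^2 \<le> (y - m)^2 \<longleftrightarrow> (m + s) / 2 \<le> y"
proof -
  have "(y - m)^2 - (y - s)^2 = 2 * (s - m) * (y - (m + s) / 2)"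
    by (simp add: power2_eq_square field_simps)
  then have "(y - s)^2 \<le> (y - m)^2 \<longleftrightarrow> 0 \<le> 2 * (s - m) * (y - (m + s) / 2)" by linarith
  also have "\<dots> \<longleftrightarrow> (m + s) / 2 \<le> y" using assms by (simp add: zero_le_mult_iff)
  finally show ?thesis .
qed

lemma benefit_psi:
  assumes "m \<le> s" shows "benefit m s = 2 * (s - m) * psi ((m + s) / 2)"
proof -
  have "pull m s y = 2 * (s - m) * max 0 (y - (m + s) / 2)" for y
  proof -
    have "(y - m)^2 - (y - s)^2 = 2 * (s - m) * (y - (m + s) / 2)"
      by (simp add: power2_eq_square field_simps)
    then show ?thesis using assms by (simp add: pull_def max_mult_distrib_left)
  qed
  then have "pull m s = (\<lambda>y. 2 * (s - m) * max 0 (y - (m + s) / 2))" by blast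
  then show ?thesis by (simp add: benefit_def psi_def)
qed

lemma benefit_eq_0: "m \<le> s \<Longrightarrow> m + s \<ge> 2 \<Longrightarrow> benefit m s = 0"
  by (simp add: benefit_psi psi_eq_0)

lemma cost_pair: "m \<le> s \<Longrightarrow> cost {m, s} = V + (m - 1/2)^2 - benefit m s"
  by (simp add: cost_two benefit_psi add.commute)

text \<open>
A code point outside the support is the less useful the farther it is away and the closer its
competitor is to it.
\<close>

lemma benefit_antimono:
  assumes "m \<le> m'" "m' < s" "1 \<le> s" "s \<le> s'"
  shows "benefit m' s' \<le> benefit m s"
  unfolding benefit_def
proof (intro mean_mono cont_pull)
  fix y :: real assume y: "y \<in> {0..1}"
  show "pull m' s' y \<le> pull m s y"
  proof (cases "(y - s')^2 \<le> (y - m')^2")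
    case True
    then have "(m' + s') / 2 \<le> y" using assms by (subst (asm) square_diff_le_iff) auto
    then have "m' \<le> y" using assms by simp
    then have "(y - m')^2 \<le> (y - m)^2" using assms by (intro power_mono) auto
    moreover have "(s - y)^2 \<le> (s' - y)^2" using assms y by (intro power_mono) auto
    ultimately show ?thesis unfolding pull_def by (simp add: power2_commute max_def)
  next
    case False
    then show ?thesis using pull_nonneg[of m s y] by (simp add: pull_def)
  qed
qed

text \<open>
A lower bound that only keeps the rightmost basic interval of level \<open>k\<close>. The rest of the Cantor set
is covered by the intervals \<open>S\<^sub>2\<^sup>j S\<^sub>1 [0, 1]\<close> with \<open>j < k\<close>, all of which end at or before
\<open>1 - r^j (1 - r)\<close>.
\<close>

lemma mean_nonneg_tail:
  assumes "continuous_on UNIV h" "\<And>j x. j < k \<Longrightarrow> 0 \<le> x \<Longrightarrow> x \<le> 1 - r^j * (1 - r) \<Longrightarrow> 0 \<le> h x"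
  shows "mean (\<lambda>x. h (1 - r^k * (1 - x))) / 2^k \<le> mean h"
  using assms
proof (induction k arbitrary: h)
  case 0
  then show ?case by simp
next
  case (Suc k)
  note c = cont_S[OF Suc.prems(1)]
  have "0 \<le> mean (\<lambda>x. h (S1 r x))"
  proof (rule order_trans[OF _ mean_mono])
    show "0 \<le> mean (\<lambda>x. 0)" by simp
    fix x :: real assume x: "x \<in> {0..1}"
    have "r * x \<le> r * 1" using x r_pos by (intro mult_left_mono) auto
    then show "0 \<le> h (S1 r x)" using x r_pos by (intro Suc.prems(2)[of 0]) (auto simp: S1_def)
  qed (auto intro: c)
  moreover have "mean (\<lambda>x. h (S2 r (1 - r^k * (1 - x)))) / 2^k \<le> mean (\<lambda>x. h (S2 r x))"
  proof (rule Suc.IH[OF c(2)])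
    fix j x assume jx: "j < k" "0 \<le> x" "x \<le> 1 - r^j * (1 - r)"
    have "r * x \<le> r * (1 - r^j * (1 - r))" using jx r_pos by (intro mult_left_mono) auto
    then have "S2 r x \<le> 1 - r^Suc j * (1 - r)" by (simp add: S2_def algebra_simps)
    moreover have "0 \<le> r * x" using jx r_pos by simp
    then have "0 \<le> S2 r x" using r_half unfolding S2_def by linarith
    ultimately show "0 \<le> h (S2 r x)"
      using jx by (intro Suc.prems(2)[of "Suc j"]) auto
  qed
  moreover have "S2 r (1 - r^k * (1 - x)) = 1 - r^Suc k * (1 - x)" for x
    by (simp add: S2_def algebra_simps)
  ultimately show ?case using mean_self[OF Suc.prems(1)] by simp
qed

text \<open>
A codebook containing a point at or to the right of \<open>m\<close> profits from a helper at \<open>s\<close> at most as much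
as the point \<open>m\<close> alone would.
\<close>

lemma cost_insert_ge_low_cover:
  assumes A: "finite A" "a \<in> A" "m \<le> a" "\<And>b. b \<in> A \<Longrightarrow> b \<le> s"
  shows "cost A - benefit m s \<le> cost (insert s A)"
proof -
  have ne: "A \<noteq> {}" using A by auto
  have cA: "continuous_on UNIV (dmin A)" "continuous_on UNIV (dmin (insert s A))"
    using A ne by (auto intro: continuous_dmin)
  have "mean (\<lambda>x. dmin A x - pull m s x) \<le> cost (insert s A)"
  proof (rule mean_mono)
    fix x
    have "dmin A x - pull m s x \<le> (x - s)^2"
    proof (cases "(x - s)^2 < (x - a)^2")
      case True
      then have "a < s" using A(4)[OF A(2)] by (cases "a = s") auto
      then have "(a + s) / 2 \<le> x" using True by (subst square_diff_le_iff[symmetric]) auto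
      then have "a \<le> x" using \<open>a < s\<close> by simp
      then have "(x - a)^2 \<le> (x - m)^2" using A(3) by (intro power_mono) auto
      then show ?thesis using dmin_le[OF A(1,2), of x] by (simp add: pull_def max_def)
    next
      case False
      then show ?thesis using dmin_le[OF A(1,2), of x] pull_nonneg[of m s x] by linarith
    qed
    then show "dmin A x - pull m s x \<le> dmin (insert s A) x"
      using pull_nonneg[of m s x] by (simp add: dmin_insert[OF A(1) ne])
  qed (intro continuous_intros cA cont_pull)+
  then show ?thesis by (simp add: benefit_def integrable_cont cA cont_pull)
qed

lemma dmin_right_of_low_cover:
  assumes A: "finite A" "A \<noteq> {}" "\<And>b. b \<in> A \<Longrightarrow> b \<le> m" and y: "m \<le> y"
  shows "(y - m)^2 \<le> dmin (insert s A) y + pull m s y"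
proof -
  have "(y - m)^2 \<le> dmin A y"
    using A y by (auto simp: dmin_ge_iff intro!: power_mono)
  then show ?thesis using min_pull[of y m s] pull_nonneg[of m s y] by (simp add: dmin_insert[OF A(1,2)] min_def split: if_splits)
qed

text \<open>
If the codebook does not reach beyond \<open>m\<close>, the helper is exchanged for the midpoint \<open>z\<close> of the rightmost
interval of level \<open>k\<close>. That is no loss anywhere to the left of \<open>z\<close>. On the interval itself, of mass
\<open>2^-k\<close>, it saves \<open>(z - m)^2\<close> against serving from \<open>m\<close>, apart from what the helper contributes.
\<close>

lemma cost_insert_exchange:
  assumes A: "finite A" "A \<noteq> {}" "\<And>b. b \<in> A \<Longrightarrow> b \<le> m"
    and s: "1 \<le> s" and k: "k \<ge> 1" "m \<le> 1 - r^k"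
  defines "z \<equiv> 1 - r^k / 2"
  shows "cost (insert z A) + (z - m)^2 / 2^k - benefit m s \<le> cost (insert s A)"
proof -
  define h where "h = (\<lambda>x. dmin (insert s A) x + pull m s x - dmin (insert z A) x)"
  have c: "continuous_on UNIV (dmin (insert s A))" "continuous_on UNIV (dmin (insert z A))"
    using A by (auto intro: continuous_dmin)
  have ch: "continuous_on UNIV h" unfolding h_def by (intro continuous_intros c cont_pull)
  have "0 \<le> r^k" using r_pos by simp
  then have zs: "z \<le> s" using s unfolding z_def by linarith
  \<comment> \<open>Left of \<open>z\<close>, the midpoint is nearer than the helper, which lies at or beyond 1.\<close>
  have low: "0 \<le> h x" if j: "j < k" and x: "0 \<le> x" "x \<le> 1 - r^j * (1 - r)" for j x
  proof -
    have "r^k \<le> r^Suc j" using j r_pos r_half by (intro power_decreasing) auto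
    also have "\<dots> \<le> r^j * (2 * (1 - r))" using r_pos r_half by simp
    finally have "x \<le> z" using x by (simp add: z_def algebra_simps)
    then have "(z - x)^2 \<le> (s - x)^2" using zs by (intro power_mono) auto
    then have "dmin (insert z A) x \<le> dmin (insert s A) x"
      by (simp add: dmin_insert[OF A(1,2)] power2_commute min_le_iff_disj)
    then show ?thesis using pull_nonneg[of m s x] by (simp add: h_def)
  qed
  have c': "continuous_on UNIV (\<lambda>x. h (1 - r^k * (1 - x)))"
    by (rule continuous_on_compose2[OF ch]) (auto intro!: continuous_intros)
  have i: "integrable P (\<lambda>x. x)" by (rule integrable_cont) (intro continuous_intros)
  have "(z - m)^2 = mean (\<lambda>x. (z - m) * (2 * (1 - r^k * (1 - x)) - m - z))"
  proof -
    have "mean (\<lambda>x. (z - m) * (2 * (1 - r^k * (1 - x)) - m - z))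
       = mean (\<lambda>x. (z - m) * (2 * (1 - r^k) - m - z) + (z - m) * 2 * r^k * x)"
      by (simp add: algebra_simps)
    also have "\<dots> = (z - m) * (2 * (1 - r^k) - m - z) + (z - m) * 2 * r^k * (1/2)"
      using i by (simp add: prob_space mean_id)
    also have "\<dots> = (z - m)^2"
    proof -
      have rk: "r^k = 2 - 2 * z" by (simp add: z_def)
      show ?thesis unfolding rk by (simp add: power2_eq_square algebra_simps)
    qed
    finally show ?thesis by simp
  qed
  also have "\<dots> \<le> mean (\<lambda>x. h (1 - r^k * (1 - x)))"
  proof (rule mean_mono)
    fix x :: real assume x: "x \<in> {0..1}"
    let ?y = "1 - r^k * (1 - x)"
    have "r^k * (1 - x) \<le> r^k * 1" using x r_pos by (intro mult_left_mono) auto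
    then have "m \<le> ?y" using k(2) by simp
    then have "(?y - m)^2 \<le> dmin (insert s A) ?y + pull m s ?y"
      by (intro dmin_right_of_low_cover A)
    moreover have "dmin (insert z A) ?y \<le> (?y - z)^2" using A by (intro dmin_le) auto
    moreover have "(?y - m)^2 - (?y - z)^2 = (z - m) * (2 * ?y - m - z)"
      by (simp add: power2_eq_square algebra_simps)
    ultimately show "(z - m) * (2 * ?y - m - z) \<le> h ?y" by (simp add: h_def)
  qed (intro continuous_intros c')+
  finally have "(z - m)^2 / 2^k \<le> mean h"
    using mean_nonneg_tail[OF ch, of k] low by (smt (verit) divide_right_mono zero_le_power)
  then show ?thesis by (simp add: h_def benefit_def integrable_cont c cont_pull)
qed

text \<open>
The two preceding bounds are complementary. If the codebook reaches \<open>m\<close>, the helper is worth at most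
\<open>benefit m s\<close>. If not, the exchange saves more than a whole additional point could have gained, so
the bound persists. The parameters \<open>k\<close> and \<open>m\<close> are free; a large \<open>m\<close> makes the benefit small or zero.
\<close>

lemma helper_bound:
  assumes A: "finite A" "A \<noteq> {}" "\<And>b. b \<in> A \<Longrightarrow> b \<le> s"
    and s: "1 \<le> s" and k: "k \<ge> 1" "m \<le> 1 - r^k"
    and D: "D (card A) \<le> cost A" "D (Suc (card A)) \<le> cost (insert (1 - r^k / 2) A)"
    and g: "gain (card A) \<le> (1 - r^k / 2 - m)^2 / 2^k"
  shows "D (card A) - benefit m s \<le> cost (insert s A)"
proof (cases "\<exists>a\<in>A. m \<le> a")
  case True
  then obtain a where "a \<in> A" "m \<le> a" by blast
  then show ?thesis using cost_insert_ge_low_cover[OF A(1) _ _ A(3), of a m] D(1) by fastforce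
next
  case False
  then have "cost (insert (1 - r^k / 2) A) + (1 - r^k / 2 - m)^2 / 2^k - benefit m s \<le> cost (insert s A)"
    using A s k by (intro cost_insert_exchange) auto
  then show ?thesis using D(2) g by (simp add: gain_def)
qed

text \<open>
A variant that uses the optimality for \<open>card A\<close> points alone, instead of that for one point more: a
codebook to the left of \<open>1/2\<close> spends on the right half of the Cantor set more than two points spend
on the whole.
\<close>

lemma helper_bound_half:
  assumes A: "finite A" "A \<noteq> {}" "\<And>b. b \<in> A \<Longrightarrow> b \<le> s" "card A \<ge> 2"
    and s: "1 \<le> s" and D: "D (card A) \<le> cost A"
  shows "D (card A) - benefit (1/2) s \<le> cost (insert s A)"
proof (cases "\<exists>a\<in>A. 1/2 \<le> a")
  case True
  then obtain a where "a \<in> A" "1/2 \<le> a" by blast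
  then show ?thesis using cost_insert_ge_low_cover[OF A(1) _ _ A(3), of a "1/2"] D by fastforce
next
  case False
  define h where "h = (\<lambda>x. dmin (insert s A) x + pull (1/2) s x)"
  have c: "continuous_on UNIV (dmin (insert s A))"
    using A by (auto intro: continuous_dmin)
  have ch: "continuous_on UNIV h" unfolding h_def by (intro continuous_intros c cont_pull)
  have c': "continuous_on UNIV (\<lambda>x. h (1 - r * (1 - x)))"
    by (rule continuous_on_compose2[OF ch]) (auto intro!: continuous_intros)
  have "r^2 * V + (1 - r)^2 / 4 = mean (\<lambda>x. (1 - r * (1 - x) - 1/2)^2)"
  proof -
    have "(1 - r * (1 - x) - 1/2)^2 = r^2 * (x - (1 - 1 / (2 * r)))^2" for x
      using r_pos by (simp add: field_simps flip: power_mult_distrib)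
    then have "mean (\<lambda>x. (1 - r * (1 - x) - 1/2)^2) = r^2 * (V + (1 - 1 / (2 * r) - 1/2)^2)"
      by (simp add: mean_square)
    also have "\<dots> = r^2 * V + (1 - r)^2 / 4" using r_pos by (simp add: power2_eq_square field_simps)
    finally show ?thesis by simp
  qed
  also have "\<dots> \<le> mean (\<lambda>x. h (1 - r * (1 - x)))"
  proof (rule mean_mono)
    fix x :: real assume x: "x \<in> {0..1}"
    let ?y = "1 - r * (1 - x)"
    have "r * (1 - x) \<le> r * 1" using x r_pos by (intro mult_left_mono) auto
    then have "1/2 \<le> ?y" using r_half by simp
    then show "(?y - 1/2)^2 \<le> h ?y"
      unfolding h_def using False A by (intro dmin_right_of_low_cover) auto
  qed (intro continuous_intros c')+
  also have "mean (\<lambda>x. h (1 - r * (1 - x))) / 2 \<le> mean h"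
    using mean_nonneg_tail[OF ch, of 1] dmin_nonneg[of "insert s A"] A(1) pull_nonneg
    by (simp add: h_def add_nonneg_nonneg)
  finally have "(r^2 * V + (1 - r)^2 / 4) / 2 \<le> mean h" by simp
  moreover have "r^2 * V \<le> (1 - r)^2 / 4"
  proof -
    have "r^2 \<le> (1/2)^2" using r_pos r_half by (intro power_mono) auto
    then have "r^2 * V \<le> (1 - r^2) * V" using V_pos by (intro mult_right_mono) (auto simp: power2_eq_square)
    then show ?thesis using V_identity by (simp add: mult.commute)
  qed
  moreover have "mean h = cost (insert s A) + benefit (1/2) s"
    by (simp add: h_def benefit_def integrable_cont c cont_pull)
  moreover have "D (card A) \<le> r^2 * V" using D_antimono[of 2 "card A"] A(4) D_2 by simp
  moreover have "X \<le> Y \<Longrightarrow> (X + Y) / 2 \<le> M \<Longrightarrow> M = c + b \<Longrightarrow> d \<le> X \<Longrightarrow> d - b \<le> c"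
    for X Y M b c d :: real by simp
  ultimately show ?thesis by blast
qed

end


section \<open>The critical ratio: two pairs sharing a point\<close>

text \<open>
The critical ratio is the zero of this quartic; the equation of degree seven defining it arises by
multiplication with \<open>(r - 1)^2 (r + 1)\<close>.
\<close>

lemma critical_polynomial_strict_mono:
  fixes x y :: real
  assumes "0 \<le> x" "x < y"
  shows "(x^2 + x)^2 + 6 * x < (y^2 + y)^2 + 6 * y"
proof -
  have "x^2 \<le> y^2" using assms by (intro power_mono) auto
  then have "(x^2 + x)^2 \<le> (y^2 + y)^2" using assms by (intro power_mono add_mono) auto
  then show ?thesis using assms(2) by linarith
qed

locale critical_cantor = cantor +
  assumes crit: "(r^2 + r)^2 = 3 - 6 * r"
begin

lemma r_bounds: "435041170 / 10^9 \<le> r" "r \<le> 435041171 / 10^9"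
proof -
  show "435041170 / 10^9 \<le> r"
  proof (rule ccontr)
    assume "\<not> ?thesis"
    then have "(r^2 + r)^2 + 6 * r < ((435041170 / 10^9)^2 + 435041170 / 10^9)^2 + 6 * (435041170 / 10^9)"
      using r_pos by (intro critical_polynomial_strict_mono) auto
    then show False unfolding crit by (simp add: power2_eq_square)
  qed
  show "r \<le> 435041171 / 10^9"
  proof (rule ccontr)
    assume "\<not> ?thesis"
    then have "((435041171 / 10^9)^2 + 435041171 / 10^9)^2 + 6 * (435041171 / 10^9) < (r^2 + r)^2 + 6 * r"
      by (intro critical_polynomial_strict_mono) auto
    then show False unfolding crit by (simp add: power2_eq_square)
  qed
qed

lemma chord_special:
  assumes "(p, h) \<in> set (chords r refinement)"
  shows "p = 0 \<Longrightarrow> h = 0" "p = 1/4 \<Longrightarrow> h = (1 - r^2) / 8" "p = 1/2 \<Longrightarrow> h = (1 - r) / 4"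
  using assms by (auto simp: refinement_def power2_eq_square field_simps)

lemma inverse_r_bounds: "1298633018 / 10^9 \<le> 1 / r - 1" "1 / r - 1 \<le> 1298633028 / 10^9"
  using r_bounds by (simp_all add: field_simps)

text \<open>
For the slopes \<open>(1/4, 1/4)\<close> the minimum over all positions equals the left-hand side by the equation
for the critical ratio, and for \<open>(0, 1/2)\<close> it does so for every ratio. All other pairs are settled by
the computation, after the sum \<open>y + y'\<close> has been rounded down to \<open>S0\<close> by moving whichever of
the two variables is large enough.
\<close>

lemma tie_chords:
  assumes ph: "(p, h) \<in> set (chords r refinement)" and qk: "(q, k) \<in> set (chords r refinement)"
    and pq: "p \<le> q" and xy: "x + y \<ge> 0" "x' + y' \<ge> 0" and S: "y + y' = 1 / r - 1"
  shows "V * (1 + r^2) \<le>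
     (V + (1 - p) * x^2 - 2 * h * x + p * y^2 - 2 * h * y)
   + (V + (1 - q) * x'^2 - 2 * k * x' + q * y'^2 - 2 * k * y')"
proof -
  have W: "2 * V - V * (1 + r^2) = (1 - r)^2 / 4"
    using V_identity by (simp add: algebra_simps)
  obtain P H A where P: "(P, H, A) \<in> set vertices" "p = real_of_int P / 128"
    "h \<le> real_of_int H / 10^9" "0 \<le> P" "H \<le> 10^9"
    "\<And>x. (1 - p) * x^2 - 2 * (real_of_int H / 10^9) * x \<ge> - real_of_int A / 10^9"
    using chords_le_vertices[OF r_bounds ph] by blast
  obtain Q K B where Q: "(Q, K, B) \<in> set vertices" "q = real_of_int Q / 128"
    "k \<le> real_of_int K / 10^9" "0 \<le> Q" "K \<le> 10^9"
    "\<And>x. (1 - q) * x^2 - 2 * (real_of_int K / 10^9) * x \<ge> - real_of_int B / 10^9"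
    using chords_le_vertices[OF r_bounds qk] by blast
  have hk: "h \<ge> 0" "k \<ge> 0"
    using chords_nonneg(3)[OF ph] chords_nonneg(3)[OF qk] r_pos r_half by auto
  have "P \<le> Q" using pq P(2) Q(2) by simp
  then have "(P = 32 \<and> Q = 32) \<or> (P = 0 \<and> (Q = 0 \<or> Q = 64)) \<or> pair_ok (P, H, A) (Q, K, B)"
    using pairs_ok_vertices P(1) Q(1) unfolding pairs_ok_def list_all_iff by fastforce
  then consider "P = 32" "Q = 32" | "P = 0" "Q = 0" | "P = 0" "Q = 64"
    | "pair_ok (P, H, A) (Q, K, B)" "0 < P + Q"
    using P(4) Q(4) by force
  then show ?thesis
  proof cases
    case 1
    then have p: "p = 1/4" "q = 1/4" using P(2) Q(2) by auto
    then have h: "h = (1 - r^2) / 8" "k = (1 - r^2) / 8"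
      using chord_special(2)[OF ph] chord_special(2)[OF qk] by auto
    define d where "d = (1 - r^2) / 2"
    have h: "h = d / 4" "k = d / 4" using h by (auto simp: d_def)
    have 1: "(1 - p) * z^2 - 2 * h * z \<ge> -(d^2 / 12)" for z
    proof -
      have "(1 - p) * z^2 - 2 * h * z = 3/4 * (z - d / 3)^2 - d^2 / 12"
        by (simp add: p h power2_eq_square field_simps)
      then show ?thesis by simp
    qed
    have 2: "p * y^2 - 2 * h * y + (q * y'^2 - 2 * k * y') \<ge> (1 / r - 1)^2 / 8 - d * (1 / r - 1) / 2"
    proof -
      have "p * y^2 - 2 * h * y + (q * y'^2 - 2 * k * y')
         = (y + y')^2 / 8 - d * (y + y') / 2 + (y - y')^2 / 8"
        by (simp add: p h power2_eq_square field_simps)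
      then show ?thesis unfolding S by simp
    qed
    have 3: "(1 - r)^2 / 4 = d^2 / 6 - (1 / r - 1)^2 / 8 + d * (1 / r - 1) / 2"
    proof -
      \<comment> \<open>This is where the defining equation of the critical ratio enters.\<close>
      have "r^2 * 24 * ((1 - r)^2 / 4 - (d^2 / 6 - (1 / r - 1)^2 / 8 + d * (1 / r - 1) / 2))
          = (1 - r)^2 * (3 - 6 * r - (r^2 + r)^2)"
        using r_pos by (simp add: d_def power2_eq_square field_simps)
      also have "\<dots> = 0" by (simp add: crit)
      finally show ?thesis using r_pos by simp
    qed
    show ?thesis using 1[of x] 1[of x'] 2 3 W unfolding h p by linarith
  next
    case 2
    then have p: "p = 0" "q = 0" using P(2) Q(2) by auto
    then have h: "h = 0" "k = 0" using chord_special(1)[OF ph] chord_special(1)[OF qk] by auto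
    have "0 \<le> (1 - r)^2 / 4" "0 \<le> x^2" "0 \<le> x'^2" by simp_all
    then have "V * (1 + r^2) \<le> V + x^2 + (V + x'^2)" using W by linarith
    then show ?thesis unfolding p h by simp
  next
    case 3
    then have p: "p = 0" "q = 1/2" using P(2) Q(2) by auto
    then have h: "h = 0" "k = (1 - r) / 4" using chord_special(1)[OF ph] chord_special(3)[OF qk] by auto
    have k: "z^2 / 2 - 2 * k * z \<ge> - 2 * k^2" for z
    proof -
      have "z^2 / 2 - 2 * k * z = (z - 2 * k)^2 / 2 - 2 * k^2"
        by (simp add: power2_eq_square field_simps)
      then show ?thesis by simp
    qed
    have k2: "(1 - r)^2 / 4 = 4 * k^2" by (simp add: h power2_eq_square field_simps)
    have "x^2 \<ge> 0" by simp
    then have "V * (1 + r^2) \<le> V + x^2 + (V + (x'^2 / 2 - 2 * k * x') + (y'^2 / 2 - 2 * k * y'))"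
      using k[of x'] k[of y'] k2 W by linarith
    then show ?thesis unfolding p h(1) by simp
  next
    case 4
    define hh kk where "hh = real_of_int H / 10^9" and "kk = real_of_int K / 10^9"
    define S0 :: real where "S0 = 1298633018 / 10^9"
    define e where "e = 1 / r - 1 - S0"
    have e: "0 \<le> e" "e \<le> 1 / 10^8" using inverse_r_bounds by (auto simp: e_def S0_def)
    have hh: "h \<le> hh" "0 \<le> hh" "hh \<le> 1" "k \<le> kk" "0 \<le> kk" "kk \<le> 1"
      using P(3,5) Q(3,5) hk by (auto simp: hh_def kk_def)
    have h1: "2 * h * (x + y) \<le> 2 * hh * (x + y)" "2 * k * (x' + y') \<le> 2 * kk * (x' + y')"
      using xy hh by (auto intro!: mult_right_mono)
    have shift: "a * z^2 - 2 * b * z \<ge> a * (z - e)^2 - 2 * b * (z - e) - 2 * e"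
      if "0 \<le> a" "b \<le> 1" "e \<le> z" for a b z
    proof -
      have "a * z^2 - 2 * b * z - (a * (z - e)^2 - 2 * b * (z - e) - 2 * e)
          = a * (e * (z + (z - e))) + 2 * ((1 - b) * e)"
        by (simp add: power2_eq_square algebra_simps)
      also have "\<dots> \<ge> 0" using that e by (intro add_nonneg_nonneg mult_nonneg_nonneg) auto
      finally show ?thesis by simp
    qed
    have pq0: "0 \<le> p" "0 \<le> q" using P(2,4) Q(2,4) by auto
    note bound = pair_ok_bound[OF 4, folded P(2) Q(2) hh_def kk_def S0_def]
    have main: "p * y^2 - 2 * hh * y + (q * y'^2 - 2 * kk * y') + 2 * e
       - real_of_int A / 10^9 - real_of_int B / 10^9 + 79794500 / 10^9 \<ge> 0"
    proof (cases "e \<le> y")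
      case True
      have y': "y' = S0 - (y - e)" using S by (simp add: e_def)
      show ?thesis using bound[of "y - e"] shift[OF pq0(1) hh(3) True] unfolding y' by linarith
    next
      case False
      then have "e \<le> y'" using S e by (simp add: e_def S0_def)
      moreover have eq: "y' - e = S0 - y" using S by (simp add: e_def)
      ultimately show ?thesis using bound[of y] shift[OF pq0(2) hh(6), of y'] unfolding eq by linarith
    qed
    have r2: "(1 - r)^2 / 4 \<ge> 79794600 / 10^9"
    proof -
      have "(564958829 / 10^9)^2 \<le> (1 - r)^2"
        using r_bounds by (intro power_mono) auto
      then show ?thesis by (simp add: power2_eq_square)
    qed
    show ?thesis
      using main P(6)[of x, folded hh_def] Q(6)[of x', folded kk_def] h1 r2 W e
      by (simp add: algebra_simps)
  qed
qed

text \<open>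
In the coordinates of the left half and of the mirrored right half of the Cantor set, one real
point \<open>a\<close> has the coordinates \<open>s = a / r\<close> and \<open>s' = (1 - a) / r\<close>. The inequality therefore says that
three points, one of which may serve both halves, are not better than one point for one half and
two for the other. Equality occurs for \<open>a = 1/2\<close>, when the shared point serves a quarter of each
half; this is the tie that determines the critical ratio.
\<close>

lemma tie:
  assumes "t \<le> s" "t' \<le> s'" "s + s' = 1 / r"
  shows "V * (1 + r^2) \<le> mean (dmin {t, s}) + mean (dmin {t', s'})"
proof -
  obtain p h where p: "(p, h) \<in> set (chords r refinement)"
    "mean (dmin {t, s}) \<ge> V + (1 - p) * (1/2 - t)^2 - 2 * h * (1/2 - t) + p * (s - 1/2)^2 - 2 * h * (s - 1/2)"
    using cost_two_ge_chord[OF assms(1)] by blast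
  obtain q k where q: "(q, k) \<in> set (chords r refinement)"
    "mean (dmin {t', s'}) \<ge> V + (1 - q) * (1/2 - t')^2 - 2 * k * (1/2 - t') + q * (s' - 1/2)^2 - 2 * k * (s' - 1/2)"
    using cost_two_ge_chord[OF assms(2)] by blast
  show ?thesis
  proof (cases "p \<le> q")
    case True
    show ?thesis
      using tie_chords[OF p(1) q(1) True, of "1/2 - t" "s - 1/2" "1/2 - t'" "s' - 1/2"] assms p(2) q(2)
      by simp
  next
    case False
    then have "q \<le> p" by simp
    from tie_chords[OF q(1) p(1) this, of "1/2 - t'" "s' - 1/2" "1/2 - t" "s - 1/2"] assms p(2) q(2)
    show ?thesis by simp
  qed
qed

end


section \<open>Numerical values of the tail function, and splitting of codebooks\<close>

context cantor
begin

lemma psi_scale: "u \<le> 1 - r \<Longrightarrow> psi (1 - u) = r / 2 * psi (1 - u / r)"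
  using psi_right[of "1 - u"] r_pos by (simp add: diff_divide_distrib)

text \<open>
Scaling by the similarity \<open>k\<close> times reduces this to the chord bound on the unit interval.
\<close>

lemma psi_le_power: "0 \<le> u \<Longrightarrow> u \<le> r^k \<Longrightarrow> psi (1 - u) \<le> u / 2^(k + 1)"
proof (induction k arbitrary: u)
  case 0
  then show ?case using psi_le_chord[of "1 - u"] by simp
next
  case (Suc k)
  have "r^Suc k \<le> r^1" using r_pos r_half by (intro power_decreasing) auto
  then have "u \<le> 1 - r" using Suc.prems r_half by simp
  then have "psi (1 - u) = r / 2 * psi (1 - u / r)" by (rule psi_scale)
  also have "\<dots> \<le> r / 2 * (u / r / 2^(k + 1))"
    using Suc.prems r_pos by (intro mult_left_mono Suc.IH) (auto simp: field_simps)
  finally show ?case using r_pos by simp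
qed

lemma psi_scale2:
  assumes "u \<le> r^2"
  shows "psi (1 - u) = r^2 / 4 * psi (1 - u / r^2)"
proof -
  have r2: "r^2 \<le> r * (1 - r)" using r_pos r_half by (simp add: power2_eq_square)
  also have "\<dots> \<le> 1 * (1 - r)" using r_pos r_half by (intro mult_right_mono) auto
  finally have "psi (1 - u) = r / 2 * psi (1 - u / r)" using assms by (intro psi_scale) auto
  moreover have "u / r \<le> 1 - r" using r2 assms r_pos by (simp add: field_simps)
  then have "psi (1 - u / r) = r / 2 * psi (1 - u / r / r)" by (rule psi_scale)
  ultimately show ?thesis by (simp add: power2_eq_square)
qed

text \<open>
The case where \<open>1 - u\<close> lies to the left of the rightmost interval of level three, inside that of level two.
\<close>

lemma psi_left_part:
  assumes "r^3 \<le> u" "u \<le> r^2"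
  shows "psi (1 - u) = r^3 / 8 * psi ((1 - u / r^2) / r) + (u - r^3 / 2) / 8"
proof -
  have "r \<le> u / r^2" using assms r_pos by (simp add: field_simps eval_nat_numeral)
  then have "psi (1 - u / r^2) = r / 2 * psi ((1 - u / r^2) / r) + (1 - r/2 - (1 - u / r^2)) / 2"
    by (intro psi_left) simp
  then show ?thesis
    unfolding psi_scale2[OF assms(2)] using r_pos by (simp add: field_simps eval_nat_numeral)
qed

lemma psi_gap:
  assumes "r^3 \<le> u" "u \<le> r^2 * (1 - r)"
  shows "psi (1 - u) = (u - r^3 / 2) / 8"
proof -
  have "r^2 * (1 - r) \<le> r^2 * 1" using r_pos by (intro mult_left_mono) auto
  then have u: "u \<le> r^2" using assms by simp
  have "1 \<le> (1 - u / r^2) / r" using assms r_pos by (simp add: field_simps)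
  then show ?thesis using psi_left_part[OF assms(1) u] psi_eq_0 by simp
qed

text \<open>
Here \<open>1 - u\<close> lies in the left third-level part of the rightmost interval of level two, and the chord over the
right part of that interval is used.
\<close>

lemma psi_left_part_le:
  assumes "r^2 * (1 - r) \<le> u" "u \<le> r^2 * (1 - r * (1 - r))" "r^3 \<le> u" "u \<le> r^2"
  shows "psi (1 - u) \<le> (u - r^2 * (1 - r)) / 32 + (u - r^3 / 2) / 8"
proof -
  define w where "w = (u - r^2 * (1 - r)) / r^3"
  have w: "(1 - u / r^2) / r = 1 - w" using r_pos by (simp add: w_def field_simps eval_nat_numeral)
  have "u - r^2 * (1 - r) \<le> r^4" using assms(2) by (simp add: algebra_simps eval_nat_numeral)
  then have "w \<le> r" using r_pos by (simp add: w_def field_simps eval_nat_numeral)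
  moreover have "0 \<le> w" using assms r_pos by (simp add: w_def)
  ultimately have "psi (1 - w) \<le> w / 4" using psi_le_power[of w 1] by simp
  then have "r^3 / 8 * psi (1 - w) \<le> r^3 / 8 * (w / 4)" using r_pos by (intro mult_left_mono) auto
  also have "\<dots> = (u - r^2 * (1 - r)) / 32" using r_pos by (simp add: w_def)
  finally show ?thesis using psi_left_part[OF assms(3,4)] by (simp add: w)
qed

lemma cost_split:
  assumes "finite A" "A \<noteq> {}"
  shows "cost A = r^2 / 2 * (cost ((\<lambda>a. a / r) ` A) + cost ((\<lambda>a. (1 - a) / r) ` A))"
proof -
  have 1: "dmin A (r * x) = r^2 * dmin ((\<lambda>a. a / r) ` A) x" for x
    using dmin_affine[OF assms, of r x 0] r_pos by simp
  have "(a - 1) / - r = (1 - a) / r" for a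
    by (metis minus_diff_eq minus_divide_divide)
  then have 2: "dmin A (1 - r * x) = r^2 * dmin ((\<lambda>a. (1 - a) / r) ` A) x" for x
    using dmin_affine[OF assms, of "-r" x 1] r_pos by (simp only: minus_mult_left[symmetric]) simp
  show ?thesis
    by (subst mean_split[OF continuous_dmin[OF assms]]) (simp add: 1 2 distrib_left add_divide_distrib)
qed

text \<open>
If \<open>p\<close> is nearest to the right end of the support, the points beyond \<open>p\<close> serve nothing.
\<close>

lemma cost_prune:
  assumes A: "finite A" "p \<in> A" "\<And>a. a \<in> A \<Longrightarrow> \<bar>p - 1\<bar> \<le> \<bar>a - 1\<bar>"
  shows "cost {a \<in> A. a \<le> p} \<le> cost A"
proof (rule mean_mono)
  let ?B = "{a \<in> A. a \<le> p}"
  show "continuous_on UNIV (dmin ?B)" "continuous_on UNIV (dmin A)"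
    using A by (auto intro!: continuous_dmin)
  fix x :: real assume x: "x \<in> {0..1}"
  have B: "finite ?B" "p \<in> ?B" using A by auto
  have "dmin ?B x \<le> (x - a)^2" if a: "a \<in> A" for a
  proof (cases "a \<le> p")
    case True
    then show ?thesis using a B by (intro dmin_le) auto
  next
    case False
    then have "\<not> (p + a) / 2 < 1" using A(3)[OF a] by (auto simp: abs_if split: if_splits)
    then have "\<not> (x - a)^2 \<le> (x - p)^2 \<or> x = (p + a) / 2"
      using False x by (subst square_diff_le_iff) auto
    then have "(x - p)^2 \<le> (x - a)^2"
    proof
      assume "x = (p + a) / 2"
      then have "x - p = - (x - a)" by simp
      then show ?thesis by (metis order_refl power2_minus)
    qed simp
    then show ?thesis using dmin_le[OF B, of x] by simp
  qed
  moreover have "A \<noteq> {}" using A(2) by blast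
  ultimately show "dmin ?B x \<le> dmin A x" using A(1) by (simp add: dmin_ge_iff)
qed

lemma cost_nonneg: "finite A \<Longrightarrow> A \<noteq> {} \<Longrightarrow> 0 \<le> cost A"
  by (rule integral_nonneg_AE) (simp add: dmin_nonneg)

lemma cost_single: "cost {a} = V + (a - 1/2)^2"
proof -
  have "dmin {a} = (\<lambda>x. (x - a)^2)" by (simp add: fun_eq_iff)
  then show ?thesis by (simp add: mean_square)
qed

text \<open>
The points \<open>r / 2\<close> and \<open>1 - r / 2\<close> are the midpoints of the two halves.
\<close>

lemma cost_two_centres: "cost {r / 2, 1 - r / 2} \<le> r^2 * V"
proof -
    have "cost B \<le> V" if "finite B" "1/2 \<in> B" for B
    proof -
      have "cost B \<le> cost {1/2}"
        using that by (intro mean_mono continuous_dmin dmin_antimono) auto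
      then show ?thesis by (simp add: cost_single)
    qed
    from this[of "(\<lambda>a. a / r) ` {r / 2, 1 - r / 2}"] this[of "(\<lambda>a. (1 - a) / r) ` {r / 2, 1 - r / 2}"]
    have "cost ((\<lambda>a. a / r) ` {r / 2, 1 - r / 2}) + cost ((\<lambda>a. (1 - a) / r) ` {r / 2, 1 - r / 2}) \<le> 2 * V"
      using r_pos by simp
    then have "r^2 / 2 * (cost ((\<lambda>a. a / r) ` {r / 2, 1 - r / 2}) + cost ((\<lambda>a. (1 - a) / r) ` {r / 2, 1 - r / 2})) \<le> r^2 / 2 * (2 * V)"
      by (intro mult_left_mono) auto
    then show ?thesis using cost_split[of "{r / 2, 1 - r / 2}"] by simp
qed

end

section \<open>The lower bound\<close>

context critical_cantor
begin

lemma power_bounds: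
  "0.18926 \<le> r^2" "r^2 \<le> 0.189261" "0.082336 \<le> r^3" "r^3 \<le> 0.082338" "0.035819 \<le> r^4"
proof -
  have "0.4350411^n \<le> r^n" "r^n \<le> 0.4350412^n" for n
    using r_bounds by (auto intro!: power_mono)
  from this[of 2] this[of 3] this[of 4]
  show "0.18926 \<le> r^2" "r^2 \<le> 0.189261" "0.082336 \<le> r^3" "r^3 \<le> 0.082338" "0.035819 \<le> r^4"
    by (simp_all add: eval_nat_numeral)
qed

lemma r_bounds': "0.4350411 \<le> r" "r \<le> 0.4350412"
  using r_bounds by auto

lemma inverse_r_bounds': "2.298633 \<le> 1 / r" "1 / r \<le> 2.29864"
  using inverse_r_bounds by auto

lemma cost_pair_pull_in:
  assumes "1 \<le> s0" "s0 \<le> s"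
  shows "cost {min t s0, s0} \<le> cost {t, s}"
proof (rule mean_mono)
  show "continuous_on UNIV (dmin {min t s0, s0})" "continuous_on UNIV (dmin {t, s})"
    by (auto intro: continuous_dmin)
  fix y :: real assume y: "y \<in> {0..1}"
  have "(s0 - y)^2 \<le> (s - y)^2" using y assms by (intro power_mono) auto
  moreover have "(s0 - y)^2 \<le> (t - y)^2" if "s0 \<le> t" using that y assms by (intro power_mono) auto
  ultimately show "dmin {min t s0, s0} y \<le> dmin {t, s} y"
    by (auto simp: dmin_insert power2_commute min_def)
qed

text \<open>
The two-pair inequality with both pairs in the same symmetric position; moving \<open>s\<close> closer to the
support only helps.
\<close>

lemma two_point_half:
  assumes "1 / (2 * r) \<le> s"
  shows "V * (1 + r^2) / 2 \<le> cost {t, s}"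
proof -
  let ?s = "1 / (2 * r)"
  have "V * (1 + r^2) \<le> cost {min t ?s, ?s} + cost {min t ?s, ?s}"
    by (rule tie) auto
  moreover have "cost {min t ?s, ?s} \<le> cost {t, s}"
    using assms inverse_r_bounds' by (intro cost_pair_pull_in) auto
  ultimately show ?thesis by simp
qed

text \<open>
Beyond the position complementary to the midpoint \<open>1 - r / 2\<close>, a helper is worthless for a single
point: the complementary pair already attains the cost of two points.
\<close>

lemma two_point_far:
  assumes "1 / r - (1 - r / 2) \<le> s"
  shows "V \<le> cost {t, s}"
proof -
  let ?s = "1 / r - (1 - r / 2)"
  have "V * (1 + r^2) \<le> cost {min t ?s, ?s} + cost {r / 2, 1 - r / 2}"
    using r_half by (intro tie) auto
  moreover have "cost {min t ?s, ?s} \<le> cost {t, s}"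
    using assms inverse_r_bounds' r_pos by (intro cost_pair_pull_in) auto
  moreover note cost_two_centres
  ultimately show ?thesis by (simp add: algebra_simps)
qed

lemma gain_2: "gain 2 = r^2 * (1 - r)^2 / 8" "gain 3 = gain 2"
  using gain_rec[of 2] gain_rec[of 3] by (simp_all add: gain_1)

lemma product_bounds: "0.245778 \<le> r * (1 - r)" "r * (1 - r) \<le> 0.245782"
proof -
  have "0.245778 \<le> 0.4350411 * (0.5649588 :: real)" by simp
  also have "\<dots> \<le> r * (1 - r)" using r_bounds' by (intro mult_mono) auto
  finally show "0.245778 \<le> r * (1 - r)" .
  have "r * (1 - r) \<le> 0.4350412 * 0.5649589" using r_bounds' by (intro mult_mono) auto
  then show "r * (1 - r) \<le> 0.245782" by simp
qed

text \<open>
The constants below are the ratio and its powers to about six digits. The tightest comparison is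
that of \<open>gain 2\<close> with the exchange at \<open>m = 0.7315\<close>, where \<open>(1 - r^2/2 - m)^2 / 4\<close> is about \<open>0.007557\<close>.
\<close>

lemma gain_2_bounds: "0.00755 \<le> gain 2" "gain 2 \<le> 0.007552"
proof -
  have e: "gain 2 = (r * (1 - r))^2 / 8" by (simp add: gain_2 power_mult_distrib)
  have "0.245778^2 \<le> (r * (1 - r))^2" "(r * (1 - r))^2 \<le> 0.245782^2"
    using product_bounds by (auto intro!: power_mono)
  then show "0.00755 \<le> gain 2" "gain 2 \<le> 0.007552" unfolding e by (simp_all add: power2_eq_square)
qed

lemma gain_4_le: "gain 4 \<le> 0.00072"
proof -
  have "gain 4 = r^2 / 2 * gain 2" using gain_rec[of 4] by simp
  also have "\<dots> \<le> 0.189261 / 2 * 0.007552"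
    using power_bounds gain_2_bounds by (intro mult_mono) auto
  finally show ?thesis by simp
qed

text \<open>
The value \<open>m = 0.7315\<close> is almost the largest one for which exchanging a helper for the midpoint of
the rightmost second-level interval pays for a gain of \<open>gain 2\<close>.
\<close>

lemma benefit_bounds:
  "benefit 0.7315 1.03 \<le> 0.00612" "benefit 0.7315 1.1986 \<le> 0.00104"
  "benefit 0.7315 1.1 \<le> 0.00398" "benefit 0.7315 1.1493 \<le> 0.00312"
  "benefit 0.5 1.1493 \<le> 0.03"
proof -
  have sub: "r^2 * (1 - r) = r^2 - r^3" "r^2 * (1 - r * (1 - r)) = r^2 - r^3 + r^4"
    by (simp_all add: algebra_simps eval_nat_numeral)
  have "psi (1 - 0.11925) \<le> (0.11925 - r^2 * (1 - r)) / 32 + (0.11925 - r^3 / 2) / 8"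
    using power_bounds by (intro psi_left_part_le) (auto simp: sub)
  also have "\<dots> = 0.01863281250 - r^2 / 32 - r^3 / 32" unfolding sub by (simp add: field_simps)
  also have "\<dots> \<le> 0.01015" using power_bounds by simp
  finally show "benefit 0.7315 1.03 \<le> 0.00612" by (simp add: benefit_psi)
  have "psi (1 - 0.03495) \<le> 0.03495 / 2^(4 + 1)"
    using power_bounds by (intro psi_le_power) auto
  then show "benefit 0.7315 1.1986 \<le> 0.00104" by (simp add: benefit_psi)
  have "psi (1 - 0.08425) = (0.08425 - r^3 / 2) / 8"
    using power_bounds by (intro psi_gap) (auto simp: sub)
  then show "benefit 0.7315 1.1 \<le> 0.00398" using power_bounds by (simp add: benefit_psi)
  have "psi (1 - 0.0596) \<le> 0.0596 / 2^(3 + 1)"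
    using power_bounds by (intro psi_le_power) auto
  then show "benefit 0.7315 1.1493 \<le> 0.00312" by (simp add: benefit_psi)
  have "psi (1 - 0.17535) \<le> 0.17535 / 2^(2 + 1)"
    using power_bounds by (intro psi_le_power) auto
  then show "benefit 0.5 1.1493 \<le> 0.03" by (simp add: benefit_psi)
qed

text \<open>
Here a code point serves both halves of the Cantor set; \<open>s\<close> and \<open>s'\<close> are its coordinates, and \<open>L\<close> and
\<open>R\<close> are the points left and right of it, \<open>R\<close> being mirrored. Since \<open>s \<le> s'\<close>, we have
\<open>s' \<ge> 1 / (2 r) > 1.149\<close>, so for \<open>R\<close> the shared point is a helper outside the support, while for \<open>L\<close> it
counts at most as one more point. If the helper is worthless for \<open>R\<close>, the claim reduces to
\<open>halves_le\<close>; this is so for four or more points in \<open>R\<close>, by an exchange in the third level. For two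
or three points in \<open>R\<close>, its benefit is compared with the two-pair inequality if \<open>L\<close> has one point,
and otherwise the benefits of both sides together stay below one gain. For one point in \<open>R\<close>, the
two-pair inequality applies, directly or in its symmetric form. If \<open>L\<close> is empty, the shared point
is so far from the centre of its own half that this costs more than the helper brings to \<open>R\<close>.
\<close>

lemma crossing_ordered:
  assumes L: "finite L" "\<And>a. a \<in> L \<Longrightarrow> a < s" and R: "finite R" "\<And>a. a \<in> R \<Longrightarrow> a < s'"
    and s: "s + s' = 1 / r" "s \<le> s'"
    and n: "n = card L + card R + 1" "2 \<le> n"
    and IH: "\<And>B. finite B \<Longrightarrow> B \<noteq> {} \<Longrightarrow> card B < n \<Longrightarrow> D (card B) \<le> cost B"
  shows "halves n \<le> cost (insert s L) + cost (insert s' R)"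
proof -
  define i j where "i = card L" and "j = card R"
  have s': "1.1493 \<le> s'" "1 / (2 * r) \<le> s'" using s inverse_r_bounds' by auto
  have cL: "D (Suc i) \<le> cost (insert s L)" if "1 \<le> j"
  proof -
    have "s \<notin> L" using L(2) by blast
    then have "card (insert s L) = Suc i" using L(1) by (simp add: i_def)
    then show ?thesis using IH[of "insert s L"] L(1) that n by (simp add: i_def j_def)
  qed
  have exch: "D (Suc (card B)) \<le> cost (insert z B)" if B: "finite B" "Suc (card B) < n" for B z
  proof -
    have "card (insert z B) \<le> Suc (card B)" using card_insert_le_m1 by (simp add: card_insert_if B)
    moreover have "1 \<le> card (insert z B)" 
      using B(1) by (metis One_nat_def Suc_leI card_gt_0_iff finite_insert insert_not_empty)
    ultimately have "D (Suc (card B)) \<le> D (card (insert z B))" by (intro D_antimono) auto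
    also have "\<dots> \<le> cost (insert z B)" using B \<open>card (insert z B) \<le> Suc (card B)\<close> by (intro IH) auto
    finally show ?thesis .
  qed
  have k2: "D (card B) - benefit 0.7315 w \<le> cost (insert w B)"
    if B: "finite B" "card B = 2 \<or> card B = 3" "Suc (card B) < n" "\<And>b. b \<in> B \<Longrightarrow> b < w" "1 \<le> w" for B w
  proof (rule helper_bound[where k = 2])
    show "finite B" "1 \<le> w" "1 \<le> (2::nat)" "B \<noteq> {}" "\<And>b. b \<in> B \<Longrightarrow> b \<le> w"
      using B by (auto intro: less_imp_le)
    show "0.7315 \<le> 1 - r^2" using power_bounds by simp
    show "D (card B) \<le> cost B" using B by (intro IH) auto
    show "D (Suc (card B)) \<le> cost (insert (1 - r^2 / 2) B)" using B by (intro exch) auto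
    have "0.173869^2 \<le> (1 - r^2 / 2 - 0.7315)^2" using power_bounds by (intro power_mono) auto
    then show "gain (card B) \<le> (1 - r^2 / 2 - 0.7315)^2 / 2^2"
      using B(2) gain_2_bounds gain_2(2) by (auto simp: power2_eq_square)
  qed
  have half: "halves n \<le> D a + D b" if "a + b = n" "1 \<le> a" "1 \<le> b" for a b
    using halves_le[of a b] that by simp
  have fin: "halves n \<le> cost (insert s L) + cost (insert s' R)"
    if "1 \<le> j" "D j \<le> cost (insert s' R)"
    using half[of "Suc i" j] that cL n by (simp add: i_def j_def)
  consider "j = 0" | "i = 0" "j = 1" | "i = 0" "2 \<le> j" | "i = 1" "j = 1" | "2 \<le> i" "j = 1"
    | "1 \<le> i" "j = 2 \<or> j = 3" | "1 \<le> i" "4 \<le> j" by linarith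
  then show ?thesis
  proof cases
    case 1
    then have [simp]: "R = {}" using R(1) by (simp add: j_def)
    have i: "1 \<le> i" using n 1 by (simp add: i_def j_def)
    have "halves n \<le> D i + D 1" using i n 1 by (intro half) (auto simp: i_def j_def)
    also have "\<dots> \<le> V + V" using D_antimono[of 1 i] i D_1 by simp
    also have "\<dots> \<le> V + (s' - 1/2)^2"
    proof -
      have "V \<le> 0.25" using r_pos r_half by (simp add: V_def field_simps)
      moreover have "0.6^2 \<le> (s' - 1/2)^2" using s' by (intro power_mono) auto
      ultimately show ?thesis by (simp add: power2_eq_square)
    qed
    also have "\<dots> \<le> cost (insert s L) + cost (insert s' R)"
      using cost_nonneg[of "insert s L"] L(1) by (simp add: cost_single)
    finally show ?thesis .
  next
    case 2
    then have [simp]: "L = {}" using L(1) by (simp add: i_def)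
    obtain t where t: "R = {t}" using 2 by (auto simp: j_def card_1_singleton_iff)
    have "halves n \<le> V + V" using half[of 1 1] n 2 D_1 by (simp add: i_def j_def)
    also have "\<dots> \<le> V + (s - 1/2)^2 + cost {t, s'}"
    proof (cases "s \<le> 1 - r / 2")
      case True
      then show ?thesis using two_point_far[of s' t] s zero_le_power2[of "s - 1/2"] by linarith
    next
      case False
      have "((1 - r) / 2)^2 \<le> (s - 1/2)^2" using False r_half by (intro power_mono) auto
      then have "(1 - r)^2 / 4 \<le> (s - 1/2)^2" by (simp add: power_divide)
      moreover have "V * (1 + r^2) / 2 = V - (1 - r)^2 / 4 / 2"
        using V_identity by (simp add: field_simps)
      ultimately show ?thesis
        using two_point_half[OF s'(2), of t] zero_le_power2[of "s - 1/2"] by linarith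
    qed
    finally show ?thesis by (simp add: t cost_single insert_commute)
  next
    case 3
    then have [simp]: "L = {}" using L(1) by (simp add: i_def)
    have "halves n \<le> V + D j" using half[of 1 j] n 3 D_1 by (simp add: i_def j_def)
    moreover have "D j - benefit 0.5 s' \<le> cost (insert s' R)"
    proof -
      have ne: "R \<noteq> {}" using 3 by (auto simp: j_def)
      have "D (card R) \<le> cost R" using R(1) ne n 3 by (intro IH) (auto simp: i_def)
      then show ?thesis
        using helper_bound_half[OF R(1) ne less_imp_le[OF R(2)]] s' 3 by (simp add: j_def)
    qed
    moreover have "benefit 0.5 s' \<le> (s - 1/2)^2"
    proof (cases "s' \<ge> 1.5")
      case True
      then show ?thesis using benefit_eq_0[of "0.5" s'] by simp
    next
      case False
      have "benefit 0.5 s' \<le> benefit 0.5 1.1493" using s' by (intro benefit_antimono) auto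
      moreover have "0.298^2 \<le> (s - 1/2)^2" using False s inverse_r_bounds' by (intro power_mono) auto
      ultimately show ?thesis using benefit_bounds(5) by (simp add: power2_eq_square)
    qed
    ultimately show ?thesis by (simp add: cost_single)
  next
    case 4
    obtain t t' where t: "L = {t}" "R = {t'}" using 4 by (auto simp: i_def j_def card_1_singleton_iff)
    have "halves n \<le> D 1 + D 2" using n 4 by (intro half) (auto simp: i_def j_def)
    also have "\<dots> = V * (1 + r^2)" by (simp add: D_1 D_2 algebra_simps)
    also have "\<dots> \<le> cost {t, s} + cost {t', s'}"
      using L(2) R(2) t s(1) by (intro tie) (auto intro: less_imp_le)
    finally show ?thesis by (simp add: t insert_commute)
  next
    case 5
    obtain t where t: "R = {t}" using 5 by (auto simp: j_def card_1_singleton_iff)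
    have "halves n \<le> D i + D 2" using n 5 by (intro half) (auto simp: i_def j_def)
    also have "\<dots> = D (Suc i) + gain i + r^2 * V" by (simp add: gain_def D_2)
    finally have "halves n \<le> D (Suc i) + gain i + r^2 * V" .
    moreover have "gain i \<le> gain 2" using 5 by (intro gain_antimono) auto
    moreover have "gain 2 + r^2 * V \<le> V * (1 + r^2) / 2"
    proof -
      have "gain 2 = r^2 / 2 * (V * (1 - r^2))" by (simp add: gain_2 V_identity)
      also have "\<dots> \<le> 1 / 2 * (V * (1 - r^2))"
        using power_bounds V_pos by (intro mult_right_mono mult_nonneg_nonneg) auto
      finally show ?thesis by (simp add: field_simps)
    qed
    moreover have "D (Suc i) \<le> cost (insert s L)" using cL 5 by simp
    moreover have "V * (1 + r^2) / 2 \<le> cost (insert s' R)"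
      using two_point_half[OF s'(2), of t] by (simp add: t insert_commute)
    ultimately show ?thesis by linarith
  next
    case 6
    have bR: "D j - benefit 0.7315 s' \<le> cost (insert s' R)"
      unfolding j_def using 6 R s' n by (intro k2) (auto simp: i_def j_def)
    have gj: "D j = D (Suc j) + gain 2" using 6 gain_2(2) by (auto simp: gain_def)
    show ?thesis
    proof (cases "s' \<ge> 1.2685")
      case True
      then have "benefit 0.7315 s' = 0" by (intro benefit_eq_0) auto
      then show ?thesis using fin bR 6 by auto
    next
      case False
      then have sb: "1.03 \<le> s" using s inverse_r_bounds' by auto
      consider "i = 1" | "i = 2 \<or> i = 3" | "4 \<le> i" using 6 by linarith
      then show ?thesis
      proof cases
        case 1
        obtain t where t: "L = {t}" using 1 by (auto simp: i_def card_1_singleton_iff)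
        have "halves n \<le> D 2 + D j" using n 1 6 by (intro half) (auto simp: i_def j_def)
        \<comment> \<open>Compare \<open>R\<close> with the single point \<open>1/2\<close>, for which the helper is worth at least as much.\<close>
        moreover have "V * (1 + r^2) \<le> cost {t, s} + cost {0.5, s'}"
          using L(2) t s(1) s' by (intro tie) (auto intro: less_imp_le)
        moreover have "cost {0.5, s'} = V - benefit 0.5 s'"
          using s' by (subst cost_pair) auto
        moreover have "benefit 0.7315 s' \<le> benefit 0.5 s'" using s' by (intro benefit_antimono) auto
        ultimately show ?thesis using bR by (simp add: t insert_commute D_2 algebra_simps)
      next
        case 2
        have bL: "D i - benefit 0.7315 s \<le> cost (insert s L)"
          unfolding i_def using 2 6 L sb n by (intro k2) (auto simp: i_def j_def)
        have "halves n \<le> D i + D (Suc j)" using n 2 6 by (intro half) (auto simp: i_def j_def)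
        moreover have "benefit 0.7315 s + benefit 0.7315 s' \<le> gain 2"
        \<comment> \<open>As \<open>s + s'\<close> is fixed, the two benefits cannot both be large; two intervals for \<open>s\<close> suffice.\<close>
        proof (cases "s \<le> 1.1")
          case True
          have "benefit 0.7315 s \<le> benefit 0.7315 1.03" using sb by (intro benefit_antimono) auto
          moreover have "benefit 0.7315 s' \<le> benefit 0.7315 1.1986"
            using True s inverse_r_bounds' by (intro benefit_antimono) auto
          ultimately show ?thesis using benefit_bounds gain_2_bounds by simp
        next
          case False
          have "benefit 0.7315 s \<le> benefit 0.7315 1.1" using False by (intro benefit_antimono) auto
          moreover have "benefit 0.7315 s' \<le> benefit 0.7315 1.1493"
            using s' by (intro benefit_antimono) auto
          ultimately show ?thesis using benefit_bounds gain_2_bounds by simp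
        qed
        ultimately show ?thesis using bL bR gj by simp
      next
        case 3
        have "halves n \<le> D i + D (Suc j)" using n 3 6 by (intro half) (auto simp: i_def j_def)
        moreover have "benefit 0.7315 s' \<le> benefit 0.7315 1.1493"
          using s' by (intro benefit_antimono) auto
        moreover have "gain i \<le> gain 4" using 3 by (intro gain_antimono) auto
        then have "D i - 0.00072 \<le> D (Suc i)" using gain_4_le by (simp add: gain_def)
        moreover have "D (Suc i) \<le> cost (insert s L)" using cL 6 by auto
        ultimately show ?thesis using bR gj benefit_bounds(4) gain_2_bounds by simp
      qed
    qed
  next
    case 7
    have "D (card R) - benefit 0.8508 s' \<le> cost (insert s' R)"
    proof (rule helper_bound[where k = 3])
      show "finite R" "1 \<le> s'" "1 \<le> (3::nat)" "R \<noteq> {}" "\<And>b. b \<in> R \<Longrightarrow> b \<le> s'"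
        using R s' 7 by (auto simp: j_def intro: less_imp_le)
      show "0.8508 \<le> 1 - r^3" using power_bounds by simp
      show "D (card R) \<le> cost R" using 7 R n by (intro IH) (auto simp: i_def j_def)
      show "D (Suc (card R)) \<le> cost (insert (1 - r^3 / 2) R)"
        using 7 R n by (intro exch) (auto simp: i_def j_def)
      have "(1/10)^2 \<le> (1 - r^3 / 2 - 0.8508)^2" using power_bounds by (intro power_mono) auto
      then have "1/100 \<le> (1 - r^3 / 2 - 0.8508)^2" by (simp only: power_one_over) simp
      moreover have "gain (card R) \<le> gain 4" using 7 by (intro gain_antimono) (auto simp: j_def)
      moreover have "gain 4 \<le> 1/100 / 2^3" using gain_4_le by simp
      ultimately show "gain (card R) \<le> (1 - r^3 / 2 - 0.8508)^2 / 2^3"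
        by (meson divide_right_mono order_trans zero_le_numeral zero_le_power)
    qed
    moreover have "benefit 0.8508 s' = 0" using s' by (intro benefit_eq_0) auto
    ultimately show ?thesis using fin 7 by (auto simp: j_def)
  qed
qed

lemma crossing:
  assumes L: "finite L" "\<And>a. a \<in> L \<Longrightarrow> a < s" and R: "finite R" "\<And>a. a \<in> R \<Longrightarrow> a < s'"
    and s: "s + s' = 1 / r"
    and n: "n = card L + card R + 1" "2 \<le> n"
    and IH: "\<And>B. finite B \<Longrightarrow> B \<noteq> {} \<Longrightarrow> card B < n \<Longrightarrow> D (card B) \<le> cost B"
  shows "halves n \<le> cost (insert s L) + cost (insert s' R)"
proof (cases "s \<le> s'")
  case True
  then show ?thesis using crossing_ordered[OF L R s True n IH] by blast
next
  case False
  then have "s' \<le> s" "s' + s = 1 / r" "n = card R + card L + 1" using s n by auto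
  from crossing_ordered[OF R L this(2,1,3) n(2) IH] show ?thesis by simp
qed

text \<open>
Let \<open>p\<close> be nearest to the right end of the left half and \<open>q\<close> nearest to the left end of the right
half. The left half is served by the points up to \<open>p\<close> and the right half by those from \<open>q\<close> on. If
\<open>p < q\<close>, the codebook falls into two smaller ones, and \<open>p > q\<close> is impossible. If \<open>p = q\<close>, this point
serves both halves.
\<close>

theorem D_le_cost:
  assumes "finite A" "A \<noteq> {}"
  shows "D (card A) \<le> cost A"
  using assms
proof (induction "card A" arbitrary: A rule: less_induct)
  case less
  define n where "n = card A"
  note IH = less.hyps[folded n_def, OF _ _ _]
  have A: "finite A" "A \<noteq> {}" using less.prems .
  then have "n \<ge> 1" by (simp add: n_def Suc_leI card_gt_0_iff)
  show ?case
  proof (cases "n = 1")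
    case True
    then obtain a where "A = {a}" using n_def by (auto simp: card_1_singleton_iff)
    then show ?thesis by (simp add: cost_single D_1)
  next
    case False
    then have n: "n \<ge> 2" using \<open>n \<ge> 1\<close> by simp
    let ?f = "\<lambda>a. a / r" and ?g = "\<lambda>a. (1 - a) / r"
    have inj: "inj_on ?f X" "inj_on ?g X" for X using r_pos by (auto simp: inj_on_def)
    define p where "p = arg_min_on (\<lambda>a. \<bar>?f a - 1\<bar>) A"
    define q where "q = arg_min_on (\<lambda>a. \<bar>?g a - 1\<bar>) A"
    have p: "p \<in> A" "\<And>a. a \<in> A \<Longrightarrow> \<bar>?f p - 1\<bar> \<le> \<bar>?f a - 1\<bar>"
      unfolding p_def using A by (auto intro: arg_min_if_finite(1) arg_min_least)
    have q: "q \<in> A" "\<And>a. a \<in> A \<Longrightarrow> \<bar>?g q - 1\<bar> \<le> \<bar>?g a - 1\<bar>"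
      unfolding q_def using A by (auto intro: arg_min_if_finite(1) arg_min_least)
    define L where "L = {a \<in> A. a \<le> p}"
    define R where "R = {a \<in> A. q \<le> a}"
    have LR: "finite L" "finite R" "p \<in> L" "q \<in> R" using A p q by (auto simp: L_def R_def)
    have "cost (?f ` L) \<le> cost (?f ` A)"
    proof -
      have "?f ` L = {b \<in> ?f ` A. b \<le> ?f p}"
        using r_pos by (auto simp: L_def divide_le_cancel)
      then show ?thesis using cost_prune[of "?f ` A" "?f p"] A p by auto
    qed
    moreover have "cost (?g ` R) \<le> cost (?g ` A)"
    proof -
      have "?g ` R = {b \<in> ?g ` A. b \<le> ?g q}"
        using r_pos by (auto simp: R_def divide_le_cancel)
      then show ?thesis using cost_prune[of "?g ` A" "?g q"] A q by auto
    qed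
    moreover have "halves n \<le> cost (?f ` L) + cost (?g ` R)"
    proof (cases p q rule: linorder_cases)
      case less
      have disj: "L \<inter> R = {}" using less by (auto simp: L_def R_def)
      have "card (L \<union> R) \<le> n" unfolding n_def by (rule card_mono) (use A in \<open>auto simp: L_def R_def\<close>)
      then have c: "card L + card R \<le> n" using card_Un_disjoint[OF LR(1,2) disj] by simp
      have pos: "1 \<le> card L" "1 \<le> card R"
        using LR by (auto simp: Suc_le_eq card_gt_0_iff)
      have "halves n \<le> halves (card L + card R)" using pos c by (intro halves_antimono) auto
      also have "\<dots> \<le> D (card L) + D (card R)" by (rule halves_le[OF pos])
      also have "D (card L) \<le> cost (?f ` L)"
        using IH[of "?f ` L"] LR c pos by (auto simp: card_image inj)
      also have "D (card R) \<le> cost (?g ` R)"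
        using IH[of "?g ` R"] LR c pos by (auto simp: card_image inj)
      finally show ?thesis by simp
    next
      case equal
      define L' where "L' = {a \<in> A. a < p}"
      define R' where "R' = {a \<in> A. p < a}"
      have L: "L = insert p L'" and R: "R = insert p R'"
        using p q equal by (auto simp: L_def R_def L'_def R'_def)
      have "A = insert p (L' \<union> R')" using p by (auto simp: L'_def R'_def)
      moreover have "p \<notin> L' \<union> R'" "L' \<inter> R' = {}" by (auto simp: L'_def R'_def)
      moreover have fin: "finite L'" "finite R'" using A by (auto simp: L'_def R'_def)
      ultimately have "n = card L' + card R' + 1"
        unfolding n_def by (metis Suc_eq_plus1 card_Un_disjoint card_insert_disjoint finite_UnI)
      moreover have "?f p + ?g p = 1 / r" by (simp flip: add_divide_distrib)
      ultimately have "halves n \<le> cost (insert (?f p) (?f ` L')) + cost (insert (?g p) (?g ` R'))"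
        using n fin IH r_pos
        by (intro crossing) (auto simp: card_image inj L'_def R'_def divide_strict_right_mono)
      then show ?thesis by (simp add: L R)
    next
      case greater
      have "\<bar>?f p - 1\<bar> \<le> \<bar>?f q - 1\<bar>" "\<bar>?g q - 1\<bar> \<le> \<bar>?g p - 1\<bar>" using p q by auto
      moreover have "\<bar>x / r - 1\<bar> = \<bar>x - r\<bar> / r" for x
      proof -
        have "x / r - 1 = (x - r) / r" using r_pos by (simp add: diff_divide_distrib)
        then show ?thesis using r_pos by (simp add: abs_divide)
      qed
      ultimately have "\<bar>p - r\<bar> \<le> \<bar>q - r\<bar>" "\<bar>1 - q - r\<bar> \<le> \<bar>1 - p - r\<bar>"
        using r_pos by (simp_all add: divide_le_cancel)
      then show ?thesis using greater r_half by (auto simp: abs_if split: if_splits)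
    qed
    ultimately have "halves n \<le> cost (?f ` A) + cost (?g ` A)" by linarith
    then have "r^2 / 2 * halves n \<le> cost A"
      unfolding cost_split[OF A] by (intro mult_left_mono) auto
    then show ?thesis using n by (simp add: D_halves flip: n_def)
  qed
qed

end


section \<open>The codebooks attain the bound\<close>

lemma S_word_simps:
  "S_word r [] x = x" "S_word r (i # \<sigma>) x = (if i = 1 then S1 r else S2 r) (S_word r \<sigma> x)"
  by (simp_all add: S_word_def)

lemma S_word_append: "S_word r (\<sigma> @ \<tau>) x = S_word r \<sigma> (S_word r \<tau> x)"
  by (induction \<sigma>) (simp_all add: S_word_simps)

lemma S_word_diff: "S_word r \<sigma> x - S_word r \<sigma> y = r^length \<sigma> * (x - y)"
proof (induction \<sigma>)
  case (Cons i \<sigma>)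
  have "S_word r (i # \<sigma>) x - S_word r (i # \<sigma>) y = r * (S_word r \<sigma> x - S_word r \<sigma> y)"
    by (simp add: S_word_simps S1_def S2_def algebra_simps)
  then show ?case by (simp add: Cons)
qed (simp add: S_word_simps)

lemma words_0: "words 0 = {[]}"
  by (auto simp: words_def)

lemma words_Suc: "words (Suc k) = (#) 1 ` words k \<union> (#) 2 ` words k"
  by (auto simp: words_def length_Suc_conv)

lemma finite_words: "finite (words k)" and card_words: "card (words k) = 2^k"
proof -
  have w: "words k = {xs. set xs \<subseteq> {1, 2} \<and> length xs = k}" by (auto simp: words_def)
  have c: "card {1, 2 :: nat} = 2" by simp
  show "finite (words k)" unfolding w by (rule finite_lists_length_eq) simp
  show "card (words k) = 2^k"
    using card_lists_length_eq[of "{1, 2 :: nat}" k] unfolding w c by simp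
qed

lemma ell_bounds:
  assumes "n \<ge> 1" shows "2 ^ ell n \<le> n" "n < 2 ^ (ell n + 1)"
proof -
  obtain l where l: "2 ^ l \<le> n" "n < 2 ^ (l + 1)"
    using ex_power_ivl1[of 2 n] assms by auto
  have uniq: "l' = l" if "2 ^ l' \<le> n \<and> n < 2 ^ (l' + 1)" for l'
  proof -
    have "(2::nat) ^ l' < 2 ^ (l + 1)" "(2::nat) ^ l < 2 ^ (l' + 1)"
      using that l by (auto intro: le_less_trans)
    then have "l' < l + 1" "l < l' + 1" by (simp_all only: power_strict_increasing_iff one_less_numeral_iff semiring_norm)
    then show ?thesis by simp
  qed
  have "ell n = l" unfolding ell_def
  proof (rule the_equality)
    show "2 ^ l \<le> n \<and> n < 2 ^ (l + 1)" using l by blast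
  qed (rule uniq)
  then show "2 ^ ell n \<le> n" "n < 2 ^ (ell n + 1)" using l by auto
qed

lemma beta_image:
  "beta r n I = a_word r ` (words (ell n) - I)
     \<union> (\<lambda>\<sigma>. a_word r (\<sigma> @ [1])) ` I \<union> (\<lambda>\<sigma>. a_word r (\<sigma> @ [2])) ` I"
  by (auto simp: beta_def)

context cantor
begin

text \<open>
Among \<open>n\<close> points, \<open>n - 2^l\<close> intervals of level \<open>l\<close> are split. The formula is linear between powers of
two, hence also correct at the right end \<open>2^(l + 1)\<close>, which the induction needs.
\<close>

lemma D_explicit:
  assumes "2^l \<le> n" "n \<le> 2^(l + 1)"
  shows "D n = r^(2 * l) * V / 2^l * ((2^(l + 1) - real n) + (real n - 2^l) * r^2)"
  using assms
proof (induction l arbitrary: n)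
  case 0
  then consider "n = 1" | "n = 2" by fastforce
  then show ?case by cases (simp_all add: D_1 D_2)
next
  case (Suc l)
  define m k where "m = n div 2" and "k = (n + 1) div 2"
  let ?F = "\<lambda>x. r^(2 * l) * V / 2^l * ((2^(l + 1) - x) + (x - 2^l) * r^2)"
  have mk: "2^l \<le> m" "m \<le> 2^(l + 1)" "2^l \<le> k" "k \<le> 2^(l + 1)"
    using Suc.prems by (auto simp: m_def k_def)
  have "m + k = n" unfolding m_def k_def by presburger
  then have "real m + real k = real n" by (metis of_nat_add)
  have "2 \<le> n" using Suc.prems(1) order_trans[of 2 "2 ^ Suc l" n] by simp
  then have "D n = r^2 / 2 * (?F m + ?F k)"
    using Suc.IH[OF mk(1,2)] Suc.IH[OF mk(3,4)] unfolding m_def k_def by (simp add: D_halves halves_def)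
  also have "?F m + ?F k = r^(2 * l) * V / 2^l * ((2^(l + 2) - (real m + real k)) + (real m + real k - 2^(l + 1)) * r^2)"
    by (simp add: algebra_simps add_divide_distrib diff_divide_distrib)
  finally show ?case by (simp add: \<open>real m + real k = real n\<close> power2_eq_square)
qed

lemma mean_words:
  assumes "continuous_on UNIV f"
  shows "mean f = (\<Sum>\<sigma>\<in>words k. mean (\<lambda>x. f (S_word r \<sigma> x))) / 2^k"
  using assms
proof (induction k arbitrary: f)
  case 0
  then show ?case by (simp add: words_0 S_word_simps)
next
  case (Suc k)
  note c = cont_S[OF Suc.prems]
  have inj: "inj_on ((#) i) (words k)" for i by simp
  have "(\<Sum>\<sigma>\<in>words (Suc k). mean (\<lambda>x. f (S_word r \<sigma> x)))
     = (\<Sum>\<sigma>\<in>(#) 1 ` words k. mean (\<lambda>x. f (S_word r \<sigma> x))) + (\<Sum>\<sigma>\<in>(#) 2 ` words k. mean (\<lambda>x. f (S_word r \<sigma> x)))"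
    unfolding words_Suc by (rule sum.union_disjoint) (auto simp: finite_words)
  also have "\<dots> = (\<Sum>\<sigma>\<in>words k. mean (\<lambda>x. f (S1 r (S_word r \<sigma> x)))) + (\<Sum>\<sigma>\<in>words k. mean (\<lambda>x. f (S2 r (S_word r \<sigma> x))))"
    by (simp add: sum.reindex inj S_word_simps)
  also have "\<dots> = 2^k * mean (\<lambda>x. f (S1 r x)) + 2^k * mean (\<lambda>x. f (S2 r x))"
    using Suc.IH[OF c(1)] Suc.IH[OF c(2)] by simp
  also have "\<dots> = 2^k * (2 * mean f)"
    unfolding distrib_left[symmetric] using mean_self[OF Suc.prems] by simp
  finally show ?case by simp
qed

lemma continuous_S_word: "continuous_on UNIV (S_word r \<sigma>)"
proof -
  define c where "c = S_word r \<sigma> 0"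
  have "S_word r \<sigma> x = c + r^length \<sigma> * x" for x
    using S_word_diff[of r \<sigma> x 0] by (simp add: c_def)
  then have eq: "S_word r \<sigma> = (\<lambda>x. c + r^length \<sigma> * x)" by (simp add: fun_eq_iff)
  show ?thesis unfolding eq by (intro continuous_intros)
qed

text \<open>
An interval outside \<open>I\<close> costs the scaled variance at its midpoint, one in \<open>I\<close> the scaled cost of the
pair of midpoints. The choice of \<open>I\<close> matters only through its size.
\<close>

lemma cost_beta_le:
  assumes n: "n \<ge> 1" and I: "I \<subseteq> words (ell n)" "card I = n - 2 ^ ell n"
  shows "finite (beta r n I)" "beta r n I \<noteq> {}" "card (beta r n I) \<le> n" "cost (beta r n I) \<le> D n"
proof -
  define l where "l = ell n"
  define B where "B = beta r n I"
  note B = beta_image[of r n I, folded B_def l_def]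
  have l: "2^l \<le> n" "n < 2^(l + 1)" using ell_bounds[OF n] by (auto simp: l_def)
  have I: "I \<subseteq> words l" "card I = n - 2^l" using I by (auto simp: l_def)
  have fin: "finite I" "finite (words l)" using I finite_words finite_subset by auto
  have cd: "card (words l - I) = 2^l - card I" using I(1) fin by (simp add: card_Diff_subset card_words)
  have finB: "finite B" using fin by (simp add: B)
  have neB: "B \<noteq> {}"
  proof -
    have "words l \<noteq> {}" using card_words[of l] by (metis card.empty power_not_zero zero_neq_numeral)
    then show ?thesis by (auto simp: B)
  qed
  have "card B \<le> (card (words l - I) + card I) + card I"
    unfolding B using fin
    by (intro order_trans[OF card_Un_le] add_mono card_image_le) auto
  then have "card B \<le> n" using cd I l card_mono[OF fin(2) I(1)] by (simp add: card_words)
  have c: "continuous_on UNIV (\<lambda>x. dmin B (S_word r \<sigma> x))" for \<sigma>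
    by (rule continuous_on_compose2[OF continuous_dmin[OF finB neB] continuous_S_word]) simp
  have 1: "mean (\<lambda>x. dmin B (S_word r \<sigma> x)) \<le> r^(2 * l) * V" if \<sigma>: "\<sigma> \<in> words l - I" for \<sigma>
  proof -
    have len: "length \<sigma> = l" using \<sigma> by (simp add: words_def)
    have "mean (\<lambda>x. dmin B (S_word r \<sigma> x)) \<le> mean (\<lambda>x. r^(2 * l) * (x - 1/2)^2)"
    proof (rule mean_mono[OF c])
      fix x
      have "dmin B (S_word r \<sigma> x) \<le> (S_word r \<sigma> x - S_word r \<sigma> (1/2))^2"
        using \<sigma> finB by (intro dmin_le) (auto simp: B a_word_def)
      then show "dmin B (S_word r \<sigma> x) \<le> r^(2 * l) * (x - 1/2)^2"
        by (simp add: S_word_diff len power_mult_distrib flip: power_mult) (simp add: mult.commute)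
    qed (intro continuous_intros)
    then show ?thesis by (simp add: mean_square)
  qed
  have 2: "mean (\<lambda>x. dmin B (S_word r \<sigma> x)) \<le> r^(2 * l) * (r^2 * V)" if \<sigma>: "\<sigma> \<in> I" for \<sigma>
  proof -
    have len: "length \<sigma> = l" using \<sigma> I by (auto simp: words_def)
    have mem: "S_word r \<sigma> (r / 2) \<in> B" "S_word r \<sigma> (1 - r / 2) \<in> B"
    proof -
      have mid: "S1 r (1/2) = r / 2" "S2 r (1/2) = 1 - r / 2" by (simp_all add: S1_def S2_def)
      have "a_word r (\<sigma> @ [1]) = S_word r \<sigma> (S1 r (1/2))"
        "a_word r (\<sigma> @ [2]) = S_word r \<sigma> (S2 r (1/2))"
        by (simp_all add: a_word_def S_word_append S_word_simps)
      then have "a_word r (\<sigma> @ [1]) = S_word r \<sigma> (r / 2)"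
        "a_word r (\<sigma> @ [2]) = S_word r \<sigma> (1 - r / 2)"
        unfolding mid .
      then show "S_word r \<sigma> (r / 2) \<in> B" "S_word r \<sigma> (1 - r / 2) \<in> B"
        unfolding B using \<sigma> by force+
    qed
    have "mean (\<lambda>x. dmin B (S_word r \<sigma> x)) \<le> mean (\<lambda>x. r^(2 * l) * dmin {r / 2, 1 - r / 2} x)"
    proof (rule mean_mono[OF c])
      fix x
      have sq: "(S_word r \<sigma> x - S_word r \<sigma> y)^2 = r^(2 * l) * (x - y)^2" for y
        by (simp add: S_word_diff len power_mult_distrib flip: power_mult) (simp add: mult.commute)
      show "dmin B (S_word r \<sigma> x) \<le> r^(2 * l) * dmin {r / 2, 1 - r / 2} x"
        using dmin_le[OF finB mem(1), of "S_word r \<sigma> x"] dmin_le[OF finB mem(2), of "S_word r \<sigma> x"]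
        by (simp add: sq dmin_insert min_def)
    qed (auto intro!: continuous_intros continuous_dmin)
    also have "\<dots> = r^(2 * l) * cost {r / 2, 1 - r / 2}" by simp
    also have "\<dots> \<le> r^(2 * l) * (r^2 * V)"
      using r_pos by (intro mult_left_mono cost_two_centres) auto
    finally show ?thesis .
  qed
  have "(\<Sum>\<sigma>\<in>words l. mean (\<lambda>x. dmin B (S_word r \<sigma> x)))
     = (\<Sum>\<sigma>\<in>words l - I. mean (\<lambda>x. dmin B (S_word r \<sigma> x))) + (\<Sum>\<sigma>\<in>I. mean (\<lambda>x. dmin B (S_word r \<sigma> x)))"
    by (rule sum.subset_diff[OF I(1) fin(2)])
  also have "\<dots> \<le> real (card (words l - I)) * (r^(2 * l) * V) + real (card I) * (r^(2 * l) * (r^2 * V))"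
    by (intro add_mono sum_bounded_above 1 2) auto
  also have "\<dots> = r^(2 * l) * V * ((2^(l + 1) - real n) + (real n - 2^l) * r^2)"
  proof -
    have cards: "real (card (words l - I)) = 2^(l + 1) - real n" "real (card I) = real n - 2^l"
      using cd I l by (simp_all add: of_nat_diff)
    show ?thesis unfolding cards by (simp add: algebra_simps)
  qed
  finally have "cost B \<le> r^(2 * l) * V * ((2^(l + 1) - real n) + (real n - 2^l) * r^2) / 2^l"
    by (subst mean_words[OF continuous_dmin[OF finB neB], of l]) (simp add: divide_right_mono)
  also have "\<dots> = D n" using D_explicit[of l n] l by simp
  finally have "cost B \<le> D n" .
  then show "finite (beta r n I)" "beta r n I \<noteq> {}" "card (beta r n I) \<le> n" "cost (beta r n I) \<le> D n"
    using finB neB \<open>card B \<le> n\<close> by (simp_all add: B_def)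
qed

end

lemma (in critical_cantor) optimal_beta:
  assumes n: "n \<ge> 1" and I: "I \<subseteq> words (ell n)" "card I = n - 2 ^ ell n"
  shows "optimal_n_means P n (beta r n I)"
proof -
  note B = cost_beta_le[OF assms]
  let ?X = "{\<alpha>. finite \<alpha> \<and> \<alpha> \<noteq> {} \<and> card \<alpha> \<le> n}"
  have lower: "D n \<le> distortion P \<alpha>" if "\<alpha> \<in> ?X" for \<alpha>
  proof -
    have "1 \<le> card \<alpha>" using that by (simp add: Suc_le_eq card_gt_0_iff)
    then have "D n \<le> D (card \<alpha>)" using that by (intro D_antimono) auto
    also have "\<dots> \<le> distortion P \<alpha>" using that D_le_cost by (simp add: distortion_dmin)
    finally show ?thesis .
  qed
  have mem: "beta r n I \<in> ?X" using B by simp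
  have "D n \<le> quantization_error P n"
    unfolding quantization_error_def using mem lower by (intro cINF_greatest) auto
  moreover have "quantization_error P n \<le> distortion P (beta r n I)"
    unfolding quantization_error_def using mem lower by (intro cINF_lower) (auto simp: bdd_below_def)
  moreover have "distortion P (beta r n I) \<le> D n" using B(4) by (simp add: distortion_dmin)
  ultimately show ?thesis using B by (simp add: optimal_n_means_def)
qed

lemma r0_equation: "0 < r0 \<and> r0 < 1/2 \<and> (r0^2 + r0)^2 = 3 - 6 * r0"
proof -
  let ?E = "\<lambda>r::real. (r - 1) * (r^4 + r^2) =
       (1/6) * (r^7 + r^6 + 4 * r^5 - 2 * r^4 - 2 * r^3 - 8 * r^2 + 9 * r - 3)"
  let ?g = "\<lambda>r::real. (r^2 + r)^2 + 6 * r"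
  have factor: "?E r \<longleftrightarrow> ?g r = 3" if r: "0 < r" "r < 1/2" for r
  proof -
    have factor: "r^7 + r^6 + 4 * r^5 - 2 * r^4 - 2 * r^3 - 8 * r^2 + 9 * r - 3 - 6 * ((r - 1) * (r^4 + r^2))
        = (r - 1)^2 * (r + 1) * ((r^2 + r)^2 + 6 * r - 3)"
      by algebra
    have clear: "x = (1/6) * y \<longleftrightarrow> y - 6 * x = 0" for x y :: real by linarith
    have "(r - 1)^2 * (r + 1) \<noteq> 0" using r by simp
    then show ?thesis unfolding clear factor mult_eq_0_iff[of "_ * _" "_ - 3"] by linarith
  qed
  have "\<exists>r. 0 \<le> r \<and> r \<le> 1/2 \<and> ?g r = 3"
    by (rule IVT') (auto simp: power2_eq_square intro!: continuous_intros)
  then obtain r where r: "0 \<le> r" "r \<le> 1/2" "?g r = 3" by blast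
  have "r \<noteq> 0" using r(3) by auto
  moreover have "r \<noteq> 1/2"
  proof
    assume half: "r = 1/2"
    show False using r(3) unfolding half by (simp add: power2_eq_square)
  qed
  ultimately have r': "0 < r" "r < 1/2" using r by auto
  have "r0 = r" unfolding r0_def
  proof (rule the_equality)
    show "0 < r \<and> r < 1/2 \<and> ?E r" using r' r(3) factor by blast
    fix r1 :: real assume r1: "0 < r1 \<and> r1 < 1/2 \<and> ?E r1"
    then have "?g r1 = 3" using factor by blast
    then show "r1 = r"
      using critical_polynomial_strict_mono[of r1 r] critical_polynomial_strict_mono[of r r1] r1 r' r(3)
      by (cases r1 r rule: linorder_cases) auto
  qed
  then show ?thesis using r' r(3) by simp
qed

theorem theorem3p1:
  fixes P :: "real measure" and n :: nat and I :: "nat list set"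
  assumes "uniform_cantor_distribution r0 P"
    and "n \<ge> 2"
    and "I \<subseteq> words (ell n)"
    and "card I = n - 2 ^ ell n"
  shows "optimal_n_means P n (beta r0 n I)"
proof -
  interpret prob_space P using assms(1) by (simp add: uniform_cantor_distribution_def)
  interpret critical_cantor P r0
    by unfold_locales (use r0_equation assms(1) in auto)
  show ?thesis by (rule optimal_beta) (use assms in auto)
qed

end
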